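(* Let $\mathbb{S}$ be the unit sphere of $\mathbb{R}^n$. Given $N$ positive real numbers $(m_i)_{1\leqslant i\leqslant N}$ with $\sum_{i=1}^N m_i=1$, and $N$ unit vectors $v_i^0\in\mathbb{S}$ (for $1\leqslant i\leqslant N$) such that $v_i^0\neq v_j^0$ for all $i\neq j$, let $(v_i)_{1\leqslant i\leqslant N}$ be the solution of the system of ordinary differential equations $$\frac{\mathrm{d}v_i}{\mathrm{d}t}=P_{v_i^\perp}J,\qquad\text{with } J(t)=\sum_{i=1}^N m_i v_i(t),$$ with the initial conditions $v_i(0)=v_i^0$ for $1\leqslant i\leqslant N$. If $J(0)\neq0$, then $t\mapsto|J(t)|$ is nondecreasing, so $\Omega(t)=\frac{J(t)}{|J(t)|}\in\mathbb{S}$ is well-defined for all times $t\geqslant0$. Furthermore there exists $\Omega_\infty\in\mathbb{S}$ such that $\Omega(t)$ converges to $\Omega_\infty$ as $t\to+\infty$, and there are only two types of possible asymptotic regimes, which are the following. (i) All the vectors $v_i$ converge to $\Omega_\infty$. Then this convergence occurs at an exponential rate $1$, and $\Omega$ converges to $\Omega_\infty$ at an exponential rate $3$. More precisely, there exist $a_i\in\{\Omega_\infty\}^\perp\subset\mathbb{R}^n$, for $1\leqslant i\leqslant N$, such that $\sum_{i=1}^N m_i a_i=0$ and that, as $t\to+\infty$, $$v_i(t)=(1-|a_i|^2e^{-2t})\,\Omega_\infty+e^{-t}a_i+O(e^{-3t})\quad\text{for }1\leqslant i\leqslant N,$$ $$\Omega(t)=\Omega_\infty+O(e^{-3t}).$$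 (ii) There exists $i_0$ such that $v_{i_0}$ converges to $-\Omega_\infty$. Then $m_{i_0}<\frac12$, and if we denote $\lambda=1-2m_{i_0}$, the vector $v_{i_0}$ converges to $-\Omega_\infty$ at an exponential rate $3\lambda$. Furthermore, all the other vectors $v_i$ for $i\neq i_0$ converge to $\Omega_\infty$ at a rate $\lambda$, and the vector $\Omega$ converges to $\Omega_\infty$ at a rate $3\lambda$. More precisely, there exist $a_i\in\{\Omega_\infty\}^\perp\subset\mathbb{R}^n$, for $i\neq i_0$, such that $\sum_{i\neq i_0}m_ia_i=0$ and that, as $t\to+\infty$, $$v_i(t)=(1-|a_i|^2e^{-2\lambda t})\,\Omega_\infty+e^{-\lambda t}a_i+O(e^{-3\lambda t})\quad\text{for }i\neq i_0,$$ $$v_{i_0}(t)=-\Omega_\infty+O(e^{-3\lambda t}),$$ $$\Omega(t)=\Omega_\infty+O(e^{-3\lambda t}).$$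
   Context: For $v\in\mathbb{S}$ and $u\in\mathbb{R}^n$, $P_{v^\perp}u=u-(v\cdot u)v$ is the projection of $u$ on the orthogonal of $v$; it ensures that the solutions $v_i(t)$ stay of norm one for all positive times. $\{\Omega_\infty\}^\perp$ is the set of vectors of $\mathbb{R}^n$ orthogonal to $\Omega_\infty$. The (exponential) rates of convergence are made precise by the displayed expansions.
   Formalization: In both expansions of v_i(t) the coefficient |a_i|^2 of the second-order term along Ω_∞ is replaced by |a_i|^2/2, since the printed coefficient contradicts |v_i(t)|=1 unless a_i=0. *)

theory Defs
  imports "HOL-Analysis.Analysis" "HOL-Library.Landau_Symbols"
begin

definition proj_perp :: "'a::real_inner \<Rightarrow> 'a \<Rightarrow> 'a" where
  "proj_perp v u = u - (v \<bullet> u) *\<^sub>R v"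

definition mean_vec :: "nat \<Rightarrow> (nat \<Rightarrow> real) \<Rightarrow> (nat \<Rightarrow> real \<Rightarrow> 'a::real_inner) \<Rightarrow> real \<Rightarrow> 'a" where
  "mean_vec N m v t = (\<Sum>i=1..N. m i *\<^sub>R v i t)"

definition mean_dir :: "nat \<Rightarrow> (nat \<Rightarrow> real) \<Rightarrow> (nat \<Rightarrow> real \<Rightarrow> 'a::real_inner) \<Rightarrow> real \<Rightarrow> 'a" where
  "mean_dir N m v t = mean_vec N m v t /\<^sub>R norm (mean_vec N m v t)"

(* That the solution stays on the unit sphere is not part of the definition: it is a
   consequence of the equation when the initial vectors are unit vectors. *)
definition aggregation_solution ::
  "nat \<Rightarrow> (nat \<Rightarrow> real) \<Rightarrow> (nat \<Rightarrow> 'a::real_inner) \<Rightarrow> (nat \<Rightarrow> real \<Rightarrow> 'a) \<Rightarrow> bool" where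
  "aggregation_solution N m v0 v \<longleftrightarrow>
     (\<forall>i\<in>{1..N}. v i 0 = v0 i \<and>
        (\<forall>t\<ge>0. (v i has_vector_derivative proj_perp (v i t) (mean_vec N m v t)) (at t within {0..})))"

(* big_O_exp f g r says f t = g t + O(exp (- r t)) as t tends to infinity. The library's O is
   for functions with values in a field, so the norm of the difference is compared. *)
definition big_O_exp :: "(real \<Rightarrow> 'a::real_normed_vector) \<Rightarrow> (real \<Rightarrow> 'a) \<Rightarrow> real \<Rightarrow> bool" where
  "big_O_exp f g r \<longleftrightarrow> (\<lambda>t. norm (f t - g t)) \<in> O[at_top](\<lambda>t. exp (- r * t))"

(* For a curve on the unit sphere, with an error of order exp (- 3 r t), the second order
   coefficient along the limit w is necessarily norm a ^ 2 / 2. This is the coefficient used in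
   the asymptotic expansions; the value norm a ^ 2 in the source lacks the factor 1/2. *)
lemma sphere_expansion_coefficient:
  fixes f :: "real \<Rightarrow> 'a::real_inner"
  assumes w: "norm w = 1" and aw: "a \<bullet> w = 0" and r: "r > 0"
    and f: "\<And>t. t \<ge> 0 \<Longrightarrow> norm (f t) = 1"
    and O: "big_O_exp f (\<lambda>t. (1 - c * exp (- 2 * r * t)) *\<^sub>R w + exp (- r * t) *\<^sub>R a) (3 * r)"
  shows "c = (norm a)\<^sup>2 / 2"
proof -
  define e where "e t = exp (- r * t)" for t :: real
  define g where "g t = (1 - c * (e t)\<^sup>2) *\<^sub>R w + e t *\<^sub>R a" for t
  have e2: "exp (- 2 * r * t) = (e t)\<^sup>2" and e3: "exp (- (3 * r) * t) = (e t) ^ 3" for t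
    by (simp_all add: e_def flip: exp_of_nat_mult)
  have e0: "e t > 0" for t
    by (simp add: e_def)
  have lim: "(e \<longlongrightarrow> 0) at_top"
  proof -
    have "LIM t at_top. r * t :> at_top"
      using r by (intro filterlim_tendsto_pos_mult_at_top[OF tendsto_const] filterlim_ident) auto
    then have "LIM t at_top. - r * t :> at_bot"
      by (simp add: filterlim_uminus_at_bot)
    then show ?thesis
      unfolding e_def by (rule filterlim_compose[OF exp_at_bot])
  qed
  from O obtain K where K: "eventually (\<lambda>t. norm (f t - g t) \<le> K * (e t) ^ 3) at_top"
    unfolding big_O_exp_def e2 e3 g_def using e0
    by (auto elim!: landau_o.bigE simp: e_def abs_mult)
  have wa: "w \<bullet> a = 0" and ww: "w \<bullet> w = 1"
    using aw w by (simp_all add: inner_commute power2_norm_eq_inner[symmetric])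
  have gsq: "(norm (g t))\<^sup>2 = (1 - c * (e t)\<^sup>2)\<^sup>2 + (e t)\<^sup>2 * (norm a)\<^sup>2" for t
    unfolding power2_norm_eq_inner g_def
    by (simp add: inner_add_left inner_add_right aw wa ww power2_eq_square)
  have bnd: "eventually (\<lambda>t. \<bar>2 * c - (norm a)\<^sup>2 - c\<^sup>2 * (e t)\<^sup>2\<bar> \<le> K * e t * (2 + K * (e t) ^ 3)) at_top"
    using K eventually_ge_at_top[of 0]
  proof eventually_elim
    case (elim t)
    have d: "\<bar>1 - norm (g t)\<bar> \<le> K * (e t) ^ 3"
      using norm_triangle_ineq3[of "f t" "g t"] f[OF elim(2)] elim(1) by simp
    have "(e t)\<^sup>2 * \<bar>2 * c - (norm a)\<^sup>2 - c\<^sup>2 * (e t)\<^sup>2\<bar> = \<bar>1 - (norm (g t))\<^sup>2\<bar>"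
    proof -
      have "1 - (norm (g t))\<^sup>2 = (e t)\<^sup>2 * (2 * c - (norm a)\<^sup>2 - c\<^sup>2 * (e t)\<^sup>2)"
        unfolding gsq by (simp add: power2_eq_square algebra_simps)
      then show ?thesis by (simp add: abs_mult)
    qed
    also have "\<dots> = \<bar>1 - norm (g t)\<bar> * (1 + norm (g t))"
    proof -
      have "1 - (norm (g t))\<^sup>2 = (1 - norm (g t)) * (1 + norm (g t))"
        by (simp add: power2_eq_square algebra_simps)
      then show ?thesis by (simp add: abs_mult)
    qed
    also have "\<dots> \<le> (K * (e t) ^ 3) * (2 + K * (e t) ^ 3)"
      using d by (intro mult_mono) auto
    also have "\<dots> = (e t)\<^sup>2 * (K * e t * (2 + K * (e t) ^ 3))"
      by (simp add: power2_eq_square power3_eq_cube)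
    finally show ?case
      using e0[of t] by (simp add: mult_le_cancel_left)
  qed
  have "((\<lambda>t. K * e t * (2 + K * (e t) ^ 3)) \<longlongrightarrow> K * 0 * (2 + K * 0 ^ 3)) at_top"
    by (intro tendsto_intros lim)
  moreover have "((\<lambda>t. \<bar>2 * c - (norm a)\<^sup>2 - c\<^sup>2 * (e t)\<^sup>2\<bar>) \<longlongrightarrow> \<bar>2 * c - (norm a)\<^sup>2 - c\<^sup>2 * 0\<^sup>2\<bar>) at_top"
    by (intro tendsto_intros lim)
  ultimately have "\<bar>2 * c - (norm a)\<^sup>2 - c\<^sup>2 * 0\<^sup>2\<bar> \<le> K * 0 * (2 + K * 0 ^ 3)"
    using bnd by (intro tendsto_le[OF trivial_limit_at_top_linorder])
  then show ?thesis by simp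
qed

end

theory Submission
  imports Defs
begin

text \<open>
  Write \<open>\<Omega>\<close> for the direction of the mean \<open>J\<close>, and split every vector as \<open>v i = c i \<Omega> + y i\<close> with \<open>y i\<close>
  orthogonal to \<open>\<Omega>\<close>. The whole proof is the study of the scalars \<open>c i\<close> and the vectors \<open>y i\<close>.

  Qualitative behaviour. The derivative of \<open>|J|\<^sup>2\<close> is twice the dissipation
  \<open>\<Sum> m i (|J|\<^sup>2 - (v i \<bullet> J)\<^sup>2)\<close>, which is nonnegative. As \<open>|J|\<close> is bounded and the dissipation has a
  bounded derivative, the dissipation tends to 0, so each \<open>c i\<close> tends to 1 (the vector is aligned) or
  to -1 (it is opposed). The separation of two vectors obeys
  \<open>(1 - v i \<bullet> v k)' = - |J| (c i + c k) (1 - v i \<bullet> v k)\<close>. For two opposed vectors it would increase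
  and could not tend to 0, so at most one vector is opposed. The limit \<open>\<lambda>\<close> of \<open>|J|\<close> is the mass of the aligned
  vectors minus that of the opposed one, which is 1 or \<open>1 - 2 m i\<^sub>0\<close>, and it is positive because \<open>|J|\<close>
  does not decrease. Up to here \<open>\<Omega>\<close> is not known to converge.

  Rates. The equations in the moving frame are
  \<open>\<Omega>' = \<Sum> m i (1 - c i) y i\<close> and \<open>y i' = - |J| c i y i - (y i \<bullet> \<Omega>') \<Omega> - c i \<Omega>'\<close>.
  The relation \<open>\<Sum> m i y i = 0\<close> turns \<open>\<Omega>' = - \<Sum> m i c i y i\<close> into the first formula, in which the
  contribution of an aligned vector is cubic in \<open>y i\<close>, since \<open>1 - c i\<close> is quadratic. For the opposed
  vector, \<open>y\<close> is repelled from 0 exponentially fast. Being bounded, it can only be as large as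
  its forcing, which is the cubic term (\<open>opposed_decays\<close>). The separation equation gives a crude rate
  \<open>\<lambda> / 2\<close> for the aligned vectors (\<open>y_decays_half\<close>). If \<open>y i = O(exp (- r t))\<close>, then \<open>\<Omega>'\<close> and the
  \<open>y\<close> of the opposed vector are \<open>O(exp (- 3 r t))\<close>, and \<open>y i' = - \<lambda> y i + O(exp (- 3 r t))\<close>, whence
  \<open>y i = exp (- \<lambda> t) a i + O(exp (- 3 r t))\<close> as soon as \<open>3 r > \<lambda>\<close> (\<open>y_expansion\<close>). Using this once with
  \<open>r = \<lambda> / 2\<close> gives the rate \<open>\<lambda>\<close> for \<open>y i\<close>, and using it again with \<open>r = \<lambda>\<close> gives the stated
  expansions. Both regimes are treated together, the set of opposed indices having at most one element.
\<close>

section \<open>Functions of exponential decay\<close>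

text \<open>
  \<open>decays r f\<close> is the case \<open>g = 0\<close> of \<open>big_O_exp\<close>. It gets a name because the proof is mostly the
  algebra of such rates: rates add up under products, and \<open>decays 0\<close> is eventual boundedness.
\<close>

definition decays :: "real \<Rightarrow> (real \<Rightarrow> 'a::real_normed_vector) \<Rightarrow> bool" where
  "decays r f \<longleftrightarrow> (\<lambda>t. norm (f t)) \<in> O[at_top](\<lambda>t. exp (- r * t))"

lemma big_O_exp_iff_decays: "big_O_exp f g r \<longleftrightarrow> decays r (\<lambda>t. f t - g t)"
  by (simp add: big_O_exp_def decays_def)

lemma decaysI:
  assumes "eventually (\<lambda>t. norm (f t) \<le> K * exp (- r * t)) at_top"
  shows "decays r f"
  unfolding decays_def by (rule bigoI[of _ K]) (use assms in simp)

lemma decaysE: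
  assumes "decays r f"
  obtains K where "K > 0" "eventually (\<lambda>t. norm (f t) \<le> K * exp (- r * t)) at_top"
  using assms unfolding decays_def by (elim landau_o.bigE) (auto simp: less_eq_real_def)

lemma decays_le:
  assumes "decays r g" "eventually (\<lambda>t. norm (f t) \<le> C * norm (g t)) at_top"
  shows "decays r f"
proof -
  have "(\<lambda>t. norm (f t)) \<in> O[at_top](\<lambda>t. norm (g t))"
    using assms(2) by (intro bigoI[of _ C]) simp
  then show ?thesis
    using assms(1) landau_o.big_trans unfolding decays_def by blast
qed

lemma decays_rate_mono:
  assumes "decays s f" "r \<le> s"
  shows "decays r f"
proof -
  from assms(1) obtain K where K: "K > 0" "eventually (\<lambda>t. norm (f t) \<le> K * exp (- s * t)) at_top"
    by (rule decaysE)
  have "eventually (\<lambda>t. norm (f t) \<le> K * exp (- r * t)) at_top"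
    using K(2) eventually_ge_at_top[of 0]
  proof eventually_elim
    case (elim t)
    have "exp (- s * t) \<le> exp (- r * t)"
      using assms(2) elim(2) by (simp add: mult_right_mono)
    with K(1) elim(1) show ?case
      by (meson less_imp_le mult_left_mono order_trans)
  qed
  then show ?thesis by (rule decaysI)
qed

lemma decays_zero: "decays r (\<lambda>_. 0)"
  by (rule decaysI[of _ 0]) simp

lemma decays_add:
  assumes "decays r f" "decays r g"
  shows "decays r (\<lambda>t. f t + g t)"
proof -
  have "(\<lambda>t. norm (f t) + norm (g t)) \<in> O[at_top](\<lambda>t. exp (- r * t))"
    using assms unfolding decays_def by (rule sum_in_bigo)
  moreover have "(\<lambda>t. norm (f t + g t)) \<in> O[at_top](\<lambda>t. norm (f t) + norm (g t))"
    by (intro bigoI[of _ 1] always_eventually) (auto simp: norm_triangle_ineq)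
  ultimately show ?thesis
    unfolding decays_def by (rule landau_o.big_trans[rotated])
qed

lemma decays_minus:
  assumes "decays r f"
  shows "decays r (\<lambda>t. - f t)"
  using assms by (simp add: decays_def)

lemma decays_diff:
  assumes "decays r f" "decays r g"
  shows "decays r (\<lambda>t. f t - g t)"
  using decays_add[OF assms(1) decays_minus[OF assms(2)]] by simp

lemma decays_sum:
  assumes "\<And>i. i \<in> A \<Longrightarrow> decays r (f i)"
  shows "decays r (\<lambda>t. \<Sum>i\<in>A. f i t)"
  using assms by (induction A rule: infinite_finite_induct) (auto intro: decays_zero decays_add)

text \<open>
  One rule for scalar multiples, inner products and squares, all of which satisfy such a bound.
\<close>

lemma decays_of_product_bound:
  assumes "decays r f" "decays s g" "\<And>t. norm (h t) \<le> norm (f t) * norm (g t)"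
  shows "decays (r + s) h"
proof -
  have "(\<lambda>t. norm (f t) * norm (g t)) \<in> O[at_top](\<lambda>t. exp (- r * t) * exp (- s * t))"
    using assms(1,2) unfolding decays_def by (rule landau_o.big.mult)
  also have "(\<lambda>t. exp (- r * t) * exp (- s * t)) = (\<lambda>t. exp (- (r + s) * t))"
    by (simp add: exp_add[symmetric] algebra_simps)
  finally have "(\<lambda>t. norm (f t) * norm (g t)) \<in> O[at_top](\<lambda>t. exp (- (r + s) * t))" .
  moreover have "(\<lambda>t. norm (h t)) \<in> O[at_top](\<lambda>t. norm (f t) * norm (g t))"
    by (rule bigoI[of _ 1]) (use assms(3) in simp)
  ultimately show ?thesis
    unfolding decays_def by (rule landau_o.big_trans[rotated])
qed

lemma decays_scaleR:
  assumes "decays r f" "decays s g"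
  shows "decays (r + s) (\<lambda>t. f t *\<^sub>R g t)"
  using assms by (rule decays_of_product_bound) simp

lemma decays_inner:
  assumes "decays r f" "decays s g"
  shows "decays (r + s) (\<lambda>t. f t \<bullet> g t)"
  using assms by (rule decays_of_product_bound) (simp add: Cauchy_Schwarz_ineq2)

lemma decays_bounded:
  assumes "eventually (\<lambda>t. norm (f t) \<le> C) at_top"
  shows "decays 0 f"
  by (rule decaysI[of _ C]) (use assms in simp)

lemma decays_const: "decays 0 (\<lambda>_. k)"
  by (rule decays_bounded[of _ "norm k"]) simp

lemma decays_exp: "decays r (\<lambda>t. exp (- r * t))"
  by (rule decaysI[of _ 1]) simp

lemma decays_cmult:
  assumes "decays r f"
  shows "decays r (\<lambda>t. k *\<^sub>R f t)"
  by (rule decays_le[OF assms, of _ "\<bar>k\<bar>"]) simp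

lemma decays_norm_power2_iff: "decays (2 * r) (\<lambda>t. (norm (f t))\<^sup>2) \<longleftrightarrow> decays r f"
proof
  assume "decays r f"
  then show "decays (2 * r) (\<lambda>t. (norm (f t))\<^sup>2)"
    unfolding mult_2 by (intro decays_of_product_bound[of r f r f]) (simp_all add: power2_eq_square)
next
  assume "decays (2 * r) (\<lambda>t. (norm (f t))\<^sup>2)"
  then obtain K where K: "K > 0"
    "eventually (\<lambda>t. norm ((norm (f t))\<^sup>2) \<le> K * exp (- (2 * r) * t)) at_top"
    by (rule decaysE)
  have "eventually (\<lambda>t. norm (f t) \<le> sqrt K * exp (- r * t)) at_top"
    using K(2)
  proof eventually_elim
    case (elim t)
    have "(sqrt K * exp (- r * t))\<^sup>2 = K * exp (- (2 * r) * t)"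
      using K(1) by (simp add: power_mult_distrib flip: exp_of_nat_mult)
    with elim have "(norm (f t))\<^sup>2 \<le> (sqrt K * exp (- r * t))\<^sup>2"
      by simp
    then show ?case
      by (rule power2_le_imp_le) (use K(1) in simp)
  qed
  then show "decays r f" by (rule decaysI)
qed

lemma decays_tendsto_zero:
  assumes "decays r f" "r > 0"
  shows "(f \<longlongrightarrow> 0) at_top"
proof -
  from assms(1) obtain K where K: "K > 0" "eventually (\<lambda>t. norm (f t) \<le> K * exp (- r * t)) at_top"
    by (rule decaysE)
  have "LIM t at_top. r * t :> at_top"
    using assms(2) by (intro filterlim_tendsto_pos_mult_at_top[OF tendsto_const] filterlim_ident) auto
  then have "LIM t at_top. - r * t :> at_bot"
    by (simp add: filterlim_uminus_at_bot)
  then have "((\<lambda>t. exp (- r * t)) \<longlongrightarrow> 0) at_top"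
    by (rule filterlim_compose[OF exp_at_bot])
  then have "((\<lambda>t. K * exp (- r * t)) \<longlongrightarrow> 0) at_top"
    by (rule tendsto_mult_right_zero)
  with K(2) show ?thesis
    by (rule Lim_null_comparison)
qed

section \<open>Differential inequalities and their asymptotic consequences\<close>

text \<open>
  The differential inequality makes \<open>exp (- c t) f t\<close> nondecreasing.
\<close>

lemma gronwall_lower:
  fixes f :: "real \<Rightarrow> real"
  assumes "a \<le> b" "continuous_on {a..b} f"
    and der: "\<And>t. a < t \<Longrightarrow> t < b \<Longrightarrow> (f has_real_derivative f' t) (at t)"
    and ineq: "\<And>t. a < t \<Longrightarrow> t < b \<Longrightarrow> f' t \<ge> c * f t"
  shows "f b \<ge> exp (c * (b - a)) * f a"
proof -
  have "exp (- c * a) * f a \<le> exp (- c * b) * f b"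
  proof (rule DERIV_nonneg_imp_increasing_open[OF assms(1)])
    fix t assume t: "a < t" "t < b"
    have "((\<lambda>t. exp (- c * t) * f t) has_real_derivative
        exp (- c * t) * (f' t - c * f t)) (at t)"
      by (auto intro!: derivative_eq_intros der t simp: algebra_simps)
    moreover have "exp (- c * t) * (f' t - c * f t) \<ge> 0"
      using ineq[OF t] by simp
    ultimately show "\<exists>y. ((\<lambda>t. exp (- c * t) * f t) has_real_derivative y) (at t) \<and> 0 \<le> y"
      by blast
  qed (intro continuous_intros assms)
  then show ?thesis
    by (simp add: exp_minus exp_diff field_simps)
qed

text \<open>
  The derivative is integrable at infinity, so \<open>f\<close> is Cauchy, and the distance to the limit is
  bounded by the integral of the tail, which decays at the same rate.
\<close>

lemma integrable_decay_converges:
  fixes f :: "real \<Rightarrow> 'a::banach"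
  assumes der: "\<And>t. t > 0 \<Longrightarrow> (f has_vector_derivative g t) (at t)"
    and g: "decays r g" and r: "r > 0"
  obtains l where "decays r (\<lambda>t. f t - l)"
proof -
  from g obtain K where K: "K > 0" "eventually (\<lambda>t. norm (g t) \<le> K * exp (- r * t)) at_top"
    by (rule decaysE)
  from eventually_conj[OF K(2) eventually_gt_at_top[of 0]] obtain T where
    T: "\<And>t. t \<ge> T \<Longrightarrow> norm (g t) \<le> K * exp (- r * t) \<and> t > 0"
    unfolding eventually_at_top_linorder by blast
  define C where "C = K / r"
  have C: "C > 0" using K r by (simp add: C_def)
  have bound: "norm (f t - f s) \<le> C * exp (- r * s)" if "T \<le> s" "s < t" for s t
  proof -
    have "norm (f t - f s) \<le> (- C * exp (- r * t)) - (- C * exp (- r * s))"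
    proof (rule differentiable_bound_general[OF \<open>s < t\<close>])
      show "continuous_on {s..t} f"
        by (intro continuous_at_imp_continuous_on ballI has_vector_derivative_continuous[OF der])
           (use T that in \<open>auto intro: order_less_le_trans\<close>)
      show "continuous_on {s..t} (\<lambda>t. - C * exp (- r * t))"
        by (intro continuous_intros)
      show "(f has_vector_derivative g x) (at x)" if "s < x" "x < t" for x
        using that \<open>T \<le> s\<close> T[of x] by (intro der) auto
      show "((\<lambda>t. - C * exp (- r * t)) has_vector_derivative K * exp (- r * x)) (at x)"
        if "s < x" "x < t" for x
        unfolding has_real_derivative_iff_has_vector_derivative[symmetric] C_def
        using r by (auto intro!: derivative_eq_intros)
      show "norm (g x) \<le> K * exp (- r * x)" if "s < x" "x < t" for x
        using that \<open>T \<le> s\<close> T[of x] by auto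
    qed
    also have "\<dots> \<le> C * exp (- r * s)"
      using C by simp
    finally show ?thesis .
  qed
  have lim0: "((\<lambda>t. C * exp (- r * t)) \<longlongrightarrow> 0) at_top"
    by (intro tendsto_mult_right_zero decays_tendsto_zero[OF decays_exp r])
  have "Cauchy (\<lambda>n. f (real n))"
  proof (rule metric_CauchyI)
    fix e :: real assume "e > 0"
    with lim0 have "eventually (\<lambda>t. C * exp (- r * t) < e / 2) at_top"
      by (intro order_tendstoD(2)[of _ 0]) auto
    from eventually_happens'[OF _ eventually_conj[OF this eventually_ge_at_top[of T]]]
    obtain s where s: "C * exp (- r * s) < e / 2" "T \<le> s"
      by auto
    have close: "dist (f (real n)) (f s) < e / 2" if "n \<ge> nat \<lceil>s\<rceil> + 1" for n
    proof -
      have "s < real n" using that by linarith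
      from bound[OF s(2) this] s(1) show ?thesis by (simp add: dist_norm)
    qed
    show "\<exists>M. \<forall>p\<ge>M. \<forall>q\<ge>M. dist (f (real p)) (f (real q)) < e"
      using close dist_triangle_half_l by blast
  qed
  then obtain l where l: "(\<lambda>n. f (real n)) \<longlonglongrightarrow> l"
    using Cauchy_convergent_iff convergent_def by blast
  have "norm (f s - l) \<le> C * exp (- r * s)" if "T \<le> s" for s
  proof (rule tendsto_upperbound)
    show "(\<lambda>n. norm (f s - f (real n))) \<longlonglongrightarrow> norm (f s - l)"
      by (intro tendsto_intros l)
    have "eventually (\<lambda>n. real n > s) sequentially"
      by (rule filterlim_real_sequentially[THEN filterlim_at_top_dense[THEN iffD1], rule_format])
    then show "eventually (\<lambda>n. norm (f s - f (real n)) \<le> C * exp (- r * s)) sequentially"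
      by eventually_elim (subst norm_minus_commute, rule bound[OF that])
  qed simp
  then have "decays r (\<lambda>t. f t - l)"
    by (intro decaysI[of _ C] eventually_at_top_linorderI)
  then show thesis by (rule that)
qed

text \<open>
  The function \<open>exp (k t) y t\<close> has derivative \<open>exp (k t) g t\<close>, which still decays because \<open>r > k\<close>.
  Its limit is the coefficient \<open>a\<close>.
\<close>

lemma forced_linear_decay_expansion:
  fixes y :: "real \<Rightarrow> 'a::banach"
  assumes der: "\<And>t. t > 0 \<Longrightarrow> (y has_vector_derivative g t - k *\<^sub>R y t) (at t)"
    and g: "decays r g" and r: "r > k"
  obtains a where "decays r (\<lambda>t. y t - exp (- k * t) *\<^sub>R a)"
proof -
  have "((\<lambda>t. exp (k * t) *\<^sub>R y t) has_vector_derivative exp (k * t) *\<^sub>R g t) (at t)" if "t > 0" for t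
  proof -
    have "((\<lambda>t. exp (k * t)) has_real_derivative k * exp (k * t)) (at t)"
      by (auto intro!: derivative_eq_intros)
    from has_vector_derivative_scaleR[OF this der[OF that]] show ?thesis
      by (simp add: algebra_simps)
  qed
  moreover have "decays (r - k) (\<lambda>t. exp (k * t) *\<^sub>R g t)"
    using decays_scaleR[OF decays_exp[of "- k"] g] by (simp add: algebra_simps)
  ultimately obtain a where "decays (r - k) (\<lambda>t. exp (k * t) *\<^sub>R y t - a)"
    using r by (elim integrable_decay_converges) auto
  from decays_scaleR[OF decays_exp[of k] this]
  have "decays r (\<lambda>t. y t - exp (- k * t) *\<^sub>R a)"
    by (simp add: scaleR_diff_right mult_exp_exp)
  then show thesis by (rule that)
qed

text \<open>
  An unstable equation forces \<open>q\<close> to grow exponentially as soon as it exceeds a fixed multiple of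
  the forcing, and a bounded function cannot do that.
\<close>

lemma bounded_unstable_decays:
  fixes q :: "real \<Rightarrow> real"
  assumes der: "\<And>t. t > 0 \<Longrightarrow> (q has_real_derivative q' t) (at t)"
    and nonneg: "\<And>t. q t \<ge> 0" and bd: "\<And>t. t > 0 \<Longrightarrow> q t \<le> M"
    and ineq: "eventually (\<lambda>t. q' t \<ge> c * q t - h t) at_top"
    and h: "decays r h" and c: "c > 0" and r: "r \<ge> 0"
  shows "decays r q"
proof -
  from h obtain K where K: "K > 0" "eventually (\<lambda>t. norm (h t) \<le> K * exp (- r * t)) at_top"
    by (rule decaysE)
  from eventually_conj[OF eventually_conj[OF K(2) ineq] eventually_gt_at_top[of 0]] obtain T where
    T: "\<And>t. t \<ge> T \<Longrightarrow> norm (h t) \<le> K * exp (- r * t) \<and> q' t \<ge> c * q t - h t \<and> t > 0"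
    unfolding eventually_at_top_linorder by auto
  \<comment> \<open>With this constant, \<open>k exp (- r t)\<close> solves \<open>p' = c p - K exp (- r t)\<close>, so subtracting it
    from \<open>q\<close> leaves the homogeneous inequality \<open>p' \<ge> c p\<close>.\<close>
  define k where "k = K / (c + r)"
  have "k > 0" "(c + r) * k = K"
    using K c r by (simp_all add: k_def)
  then have k: "k > 0" "c * k + r * k = K"
    by (simp_all add: distrib_right)
  define p where "p t = q t - k * exp (- r * t)" for t
  have growth: "p b \<ge> exp (c * (b - a)) * p a" if "T \<le> a" "a \<le> b" for a b
  proof (rule gronwall_lower[OF \<open>a \<le> b\<close>])
    have pder: "(p has_real_derivative q' t + r * k * exp (- r * t)) (at t)" if "t > 0" for t
      unfolding p_def by (auto intro!: derivative_eq_intros der that)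
    show "(p has_real_derivative q' t + r * k * exp (- r * t)) (at t)" if "a < t" "t < b" for t
      using that \<open>T \<le> a\<close> T[of t] by (intro pder) auto
    show "continuous_on {a..b} p"
      by (intro continuous_at_imp_continuous_on ballI DERIV_isCont[OF pder])
         (use T \<open>T \<le> a\<close> in \<open>auto intro: order_less_le_trans\<close>)
    fix t assume "a < t" "t < b"
    then have "h t \<le> K * exp (- r * t)" "q' t \<ge> c * q t - h t"
      using T[of t] \<open>T \<le> a\<close> by auto
    then have "q' t + r * k * exp (- r * t) \<ge> c * q t - K * exp (- r * t) + r * k * exp (- r * t)"
      by linarith
    also have "c * q t - K * exp (- r * t) + r * k * exp (- r * t) = c * p t"
      unfolding k(2)[symmetric] p_def by (simp add: algebra_simps)
    finally show "c * p t \<le> q' t + r * k * exp (- r * t)" .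
  qed
  have "p a \<le> 0" if "T \<le> a" for a
  proof (rule ccontr)
    assume "\<not> p a \<le> 0"
    then have pa: "p a > 0" by simp
    \<comment> \<open>By this time even the linear lower bound \<open>(1 + c (b - a)) p a\<close> of the exponential exceeds \<open>M\<close>.\<close>
    define b where "b = a + M / (c * p a)"
    have M: "M \<ge> 0"
      using nonneg[of 1] bd[of 1] by simp
    have "a \<le> b" using M c pa by (simp add: b_def)
    have "p b \<ge> exp (c * (b - a)) * p a"
      using that \<open>a \<le> b\<close> by (rule growth)
    moreover have "exp (c * (b - a)) * p a \<ge> (1 + c * (b - a)) * p a"
      using pa by (intro mult_right_mono exp_ge_add_one_self) auto
    moreover have "(1 + c * (b - a)) * p a = p a + M"
      using c pa by (simp add: b_def field_simps)
    moreover have "p b \<le> M"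
    proof -
      have "b > 0" using T[OF that] \<open>a \<le> b\<close> by linarith
      moreover have "k * exp (- r * b) \<ge> 0" using k(1) by simp
      ultimately show ?thesis using bd[of b] unfolding p_def by linarith
    qed
    ultimately show False using pa by linarith
  qed
  then have "norm (q t) \<le> k * exp (- r * t)" if "T \<le> t" for t
    using that nonneg[of t] by (simp add: p_def)
  then show ?thesis
    by (intro decaysI[of _ k] eventually_at_top_linorderI)
qed

lemma stable_decays:
  fixes w :: "real \<Rightarrow> real"
  assumes der: "\<And>t. t > 0 \<Longrightarrow> (w has_real_derivative - k t * w t) (at t)"
    and nonneg: "\<And>t. t > 0 \<Longrightarrow> w t \<ge> 0"
    and ge: "eventually (\<lambda>t. k t \<ge> c) at_top"
  shows "decays c w"
proof -
  from eventually_conj[OF ge eventually_gt_at_top[of 0]] obtain T where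
    T: "\<And>t. t \<ge> T \<Longrightarrow> k t \<ge> c \<and> t > 0"
    unfolding eventually_at_top_linorder by auto
  have "norm (w t) \<le> (exp (c * T) * w T) * exp (- c * t)" if "T \<le> t" for t
  proof -
    have "- w t \<ge> exp (- c * (t - T)) * - w T"
    proof (rule gronwall_lower[OF that])
      have der': "((\<lambda>t. - w t) has_real_derivative k s * w s) (at s)" if "s > 0" for s
        using DERIV_minus[OF der[OF that]] by simp
      show "((\<lambda>t. - w t) has_real_derivative k s * w s) (at s)" if "T < s" "s < t" for s
        using that T[of s] by (intro der') auto
      show "continuous_on {T..t} (\<lambda>t. - w t)"
        by (intro continuous_at_imp_continuous_on ballI DERIV_isCont[OF der'])
           (use T in \<open>auto intro: order_less_le_trans\<close>)
      show "- c * - w s \<le> k s * w s" if "T < s" "s < t" for s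
        using that T[of s] nonneg[of s] by (auto intro: mult_right_mono)
    qed
    then have "w t \<le> (exp (c * T) * w T) * exp (- c * t)"
      by (simp add: algebra_simps exp_diff exp_minus divide_inverse)
    with nonneg[of t] T[OF that] show ?thesis by simp
  qed
  then show ?thesis
    by (intro decaysI eventually_at_top_linorderI)
qed

text \<open>
  A form of the lemma of Barbalat: where \<open>f\<close> is at least \<open>e\<close>, the bound on its derivative keeps it
  large during a time \<open>h\<close>, and \<open>F\<close> gains a fixed amount. Close to its supremum \<open>F\<close> has no such gain left.
\<close>

lemma bounded_increasing_derivative_tendsto_zero:
  fixes F :: "real \<Rightarrow> real"
  assumes F: "\<And>t. t > 0 \<Longrightarrow> (F has_real_derivative f t) (at t)"
    and f: "\<And>t. t > 0 \<Longrightarrow> (f has_real_derivative f' t) (at t)"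
    and nonneg: "\<And>t. t > 0 \<Longrightarrow> f t \<ge> 0" and bd: "\<And>t. t > 0 \<Longrightarrow> F t \<le> M"
    and L: "\<And>t. t > 0 \<Longrightarrow> f' t \<ge> - L"
  shows "(f \<longlongrightarrow> 0) at_top"
proof -
  have mono: "F s \<le> F t" if "0 < s" "s \<le> t" for s t
    by (rule DERIV_nonneg_imp_nondecreasing[OF that(2)])
       (use F nonneg that in \<open>blast intro: order_less_le_trans\<close>)
  define S where "S = Sup (F ` {0<..})"
  have bdd: "bdd_above (F ` {0<..})"
    using bd by (auto intro!: bdd_aboveI[of _ M])
  have le_S: "F t \<le> S" if "t > 0" for t
    unfolding S_def using that bdd by (intro cSup_upper) auto
  show ?thesis
  proof (rule tendstoI)
    fix e :: real assume e: "e > 0"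
    define h where "h = e / (\<bar>L\<bar> + 1)"
    have h: "h > 0" "\<bar>L\<bar> * h < e"
      using e by (auto simp: h_def field_simps)
    have "\<exists>s>0. F s > S - h * (e - \<bar>L\<bar> * h)"
    proof -
      have "S - h * (e - \<bar>L\<bar> * h) < S" using h e by simp
      then show ?thesis
        unfolding S_def using less_cSupD[of "F ` {0<..}"] by force
    qed
    then obtain s where s: "s > 0" "F s > S - h * (e - \<bar>L\<bar> * h)" by blast
    have "dist (f t) 0 < e" if "t \<ge> s" for t
    proof (rule ccontr)
      assume "\<not> dist (f t) 0 < e"
      then have fe: "f t \<ge> e" using nonneg[of t] s that by simp
      have t: "t > 0" using s that by simp
      have "\<exists>z>t. z < t + h \<and> F (t + h) - F t = (t + h - t) * f z"
        by (rule MVT2) (use t h F in auto)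
      then obtain z where z: "t < z" "z < t + h" "F (t + h) - F t = h * f z" by auto
      have "\<exists>u>t. u < z \<and> f z - f t = (z - t) * f' u"
        by (rule MVT2) (use t z f in auto)
      then obtain u where u: "t < u" "u < z" "f z - f t = (z - t) * f' u" by blast
      have "(z - t) * f' u \<ge> (z - t) * - \<bar>L\<bar>"
        using L[of u] t u z by (intro mult_left_mono) auto
      moreover have "(z - t) * \<bar>L\<bar> \<le> h * \<bar>L\<bar>"
        using z by (intro mult_right_mono) auto
      ultimately have "f z \<ge> e - \<bar>L\<bar> * h"
        using u(3) fe by (simp add: algebra_simps)
      then have "h * f z \<ge> h * (e - \<bar>L\<bar> * h)"
        using h by simp
      then have "F (t + h) \<ge> F t + h * (e - \<bar>L\<bar> * h)"
        using z(3) by linarith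
      moreover have "F t \<ge> F s" using s that by (intro mono) auto
      ultimately have "F (t + h) > S" using s(2) by linarith
      with le_S[of "t + h"] t h show False by simp
    qed
    then show "eventually (\<lambda>t. dist (f t) 0 < e) at_top"
      by (intro eventually_at_top_linorderI)
  qed
qed

text \<open>
  Once \<open>f\<close> no longer vanishes, the intermediate value theorem fixes its sign.
\<close>

lemma tendsto_one_or_minus_one:
  fixes f :: "real \<Rightarrow> real"
  assumes lim: "((\<lambda>t. (f t)\<^sup>2) \<longlongrightarrow> 1) at_top" and cont: "continuous_on {0<..} f"
  shows "(f \<longlongrightarrow> 1) at_top \<or> (f \<longlongrightarrow> - 1) at_top"
proof -
  have "eventually (\<lambda>t. (f t)\<^sup>2 > 0) at_top"
    by (rule order_tendstoD(1)[OF lim]) simp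
  from eventually_conj[OF this eventually_gt_at_top[of 0]] obtain T where
    T: "\<And>t. t \<ge> T \<Longrightarrow> f t \<noteq> 0 \<and> t > 0"
    unfolding eventually_at_top_linorder by auto
  have conn: "connected (f ` {T..})"
    using cont T by (intro connected_continuous_image continuous_on_subset[OF cont]) auto
  have abs: "((\<lambda>t. \<bar>f t\<bar>) \<longlongrightarrow> 1) at_top"
    using tendsto_real_sqrt[OF lim] by simp
  show ?thesis
  proof (cases "f T > 0")
    case True
    have "f t > 0" if "t \<ge> T" for t
    proof (rule ccontr)
      assume "\<not> f t > 0"
      moreover have "f t \<in> f ` {T..}" "f T \<in> f ` {T..}"
        using that by auto
      ultimately have "0 \<in> f ` {T..}"
        using True conn unfolding connected_iff_interval by (meson less_imp_le not_less)
      with T show False by auto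
    qed
    then have "eventually (\<lambda>t. \<bar>f t\<bar> = f t) at_top"
      by (intro eventually_at_top_linorderI[of T]) (simp add: less_imp_le)
    with abs have "(f \<longlongrightarrow> 1) at_top" by (simp add: tendsto_cong)
    then show ?thesis ..
  next
    case False
    have "f t < 0" if "t \<ge> T" for t
    proof (rule ccontr)
      assume "\<not> f t < 0"
      moreover have "f t \<in> f ` {T..}" "f T \<in> f ` {T..}"
        using that by auto
      ultimately have "0 \<in> f ` {T..}"
        using False conn unfolding connected_iff_interval by (meson less_imp_le not_less)
      with T show False by auto
    qed
    then have "eventually (\<lambda>t. \<bar>f t\<bar> = - f t) at_top"
      by (intro eventually_at_top_linorderI[of T]) (simp add: less_imp_le)
    with abs have "((\<lambda>t. - f t) \<longlongrightarrow> 1) at_top" by (simp add: tendsto_cong)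
    then show ?thesis using tendsto_minus[of "\<lambda>t. - f t" 1 at_top] by simp
  qed
qed

section \<open>Projections and unit directions\<close>

lemma proj_perp_diff: "proj_perp w (x - y) = proj_perp w x - proj_perp w y"
  by (simp add: proj_perp_def inner_diff_right scaleR_diff_left)

lemma proj_perp_scaleR: "proj_perp w (k *\<^sub>R x) = k *\<^sub>R proj_perp w x"
  by (simp add: proj_perp_def scaleR_diff_right)

lemma proj_perp_sum: "proj_perp w (\<Sum>i\<in>A. f i) = (\<Sum>i\<in>A. proj_perp w (f i))"
  by (simp add: proj_perp_def inner_sum_right scaleR_sum_left sum_subtractf)

lemma proj_perp_self: "norm w = 1 \<Longrightarrow> proj_perp w w = 0"
  by (simp add: proj_perp_def power2_norm_eq_inner[symmetric])

lemma inner_proj_perp_self: "norm w = 1 \<Longrightarrow> w \<bullet> proj_perp w x = 0"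
  by (simp add: proj_perp_def inner_diff_right power2_norm_eq_inner[symmetric])

lemma norm_proj_perp_power2:
  assumes "norm w = 1"
  shows "(norm (proj_perp w x))\<^sup>2 = (norm x)\<^sup>2 - (w \<bullet> x)\<^sup>2"
proof -
  have "w \<bullet> w = 1" using assms by (simp add: power2_norm_eq_inner[symmetric])
  then show ?thesis
    unfolding proj_perp_def power2_norm_eq_inner inner_diff_left inner_diff_right
    by (simp add: inner_commute power2_eq_square)
qed

lemma norm_proj_perp_le: "norm w = 1 \<Longrightarrow> norm (proj_perp w x) \<le> norm x"
  by (rule power2_le_imp_le) (simp_all add: norm_proj_perp_power2)

lemma has_real_derivative_inner:
  assumes "(f has_vector_derivative f') (at t)" "(g has_vector_derivative g') (at t)"
  shows "((\<lambda>t. f t \<bullet> g t) has_real_derivative f t \<bullet> g' + f' \<bullet> g t) (at t)"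
  unfolding has_real_derivative_iff_has_vector_derivative
  by (rule bounded_bilinear.has_vector_derivative[OF bounded_bilinear_inner assms])

lemma has_vector_derivative_direction:
  fixes f :: "real \<Rightarrow> 'a::real_inner"
  assumes f: "(f has_vector_derivative f') (at t)" and nz: "f t \<noteq> 0"
  shows "((\<lambda>t. f t /\<^sub>R norm (f t)) has_vector_derivative
    proj_perp (f t /\<^sub>R norm (f t)) f' /\<^sub>R norm (f t)) (at t)"
proof -
  let ?n = "norm (f t)"
  have n: "?n > 0" using nz by simp
  have norm_deriv: "((\<lambda>t. norm (f t)) has_real_derivative (f t \<bullet> f') / ?n) (at t)"
  proof -
    have pos: "f t \<bullet> f t > 0" using nz by simp
    have "((\<lambda>t. sqrt (f t \<bullet> f t)) has_real_derivative
        inverse (sqrt (f t \<bullet> f t)) / 2 * (f t \<bullet> f' + f' \<bullet> f t)) (at t)"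
      by (rule DERIV_chain2[OF DERIV_real_sqrt[OF pos] has_real_derivative_inner[OF f f]])
    moreover have "inverse (sqrt (f t \<bullet> f t)) / 2 * (f t \<bullet> f' + f' \<bullet> f t) = (f t \<bullet> f') / ?n"
      unfolding norm_eq_sqrt_inner[symmetric] inner_commute[of f' "f t"]
      by (simp add: field_simps)
    ultimately show ?thesis
      by (simp only: norm_eq_sqrt_inner[symmetric])
  qed
  have "((\<lambda>t. inverse (norm (f t))) has_real_derivative - ((f t \<bullet> f') / ?n) / ?n ^ 2) (at t)"
    using n by (auto intro!: derivative_eq_intros norm_deriv simp: power2_eq_square field_simps)
  from has_vector_derivative_scaleR[OF this f]
  have "((\<lambda>t. f t /\<^sub>R norm (f t)) has_vector_derivative
      f' /\<^sub>R ?n - ((f t \<bullet> f') / ?n ^ 3) *\<^sub>R f t) (at t)"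
    by (simp add: power2_eq_square power3_eq_cube mult.assoc)
  moreover have "f' /\<^sub>R ?n - ((f t \<bullet> f') / ?n ^ 3) *\<^sub>R f t =
      proj_perp (f t /\<^sub>R ?n) f' /\<^sub>R ?n"
    by (simp add: proj_perp_def scaleR_diff_right power3_eq_cube field_simps)
  ultimately show ?thesis by simp
qed

text \<open>
  Uniqueness for a scalar linear equation, by comparison: on a compact interval \<open>k\<close> is bounded by a
  constant \<open>C\<close>, and \<open>y\<^sup>2\<close> grows at most like \<open>exp (2 C t)\<close> times its initial value, which is 0.
\<close>

lemma linear_ode_vanishes:
  fixes y :: "real \<Rightarrow> real"
  assumes der: "\<And>t. t > 0 \<Longrightarrow> (y has_real_derivative k t * y t) (at t)"
    and cont: "continuous_on {0..} y" "continuous_on {0..} k" and init: "y 0 = 0" and t: "t \<ge> 0"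
  shows "y t = 0"
proof -
  have "bounded (k ` {0..t})"
    using cont(2) by (intro compact_imp_bounded compact_continuous_image) (auto intro: continuous_on_subset)
  then obtain C where "\<forall>x\<in>k ` {0..t}. norm x \<le> C"
    unfolding bounded_iff by blast
  then have C: "\<bar>k s\<bar> \<le> C" if "s \<in> {0..t}" for s
    using that by simp
  have "- (y t)\<^sup>2 \<ge> exp (2 * C * (t - 0)) * - (y 0)\<^sup>2"
  proof (rule gronwall_lower[OF t])
    show "continuous_on {0..t} (\<lambda>t. - (y t)\<^sup>2)"
      using cont(1) by (intro continuous_intros) (auto intro: continuous_on_subset)
    fix s assume s: "0 < s" "s < t"
    show "((\<lambda>t. - (y t)\<^sup>2) has_real_derivative - (2 * k s * (y s)\<^sup>2)) (at s)"
      by (auto intro!: derivative_eq_intros der s simp: power2_eq_square)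
    have "k s * (y s)\<^sup>2 \<le> C * (y s)\<^sup>2"
      using C[of s] s by (intro mult_right_mono) auto
    then show "2 * C * - (y s)\<^sup>2 \<le> - (2 * k s * (y s)\<^sup>2)"
      by simp
  qed
  then show ?thesis using init by simp
qed

section \<open>The aggregation equation\<close>

locale aggregation =
  fixes N :: nat and m :: "nat \<Rightarrow> real"
    and v0 :: "nat \<Rightarrow> 'a::{real_inner, banach}" and v :: "nat \<Rightarrow> real \<Rightarrow> 'a"
  assumes mass_pos: "i \<in> {1..N} \<Longrightarrow> m i > 0"
    and mass_sum: "(\<Sum>i=1..N. m i) = 1"
    and initial_unit: "i \<in> {1..N} \<Longrightarrow> norm (v0 i) = 1"
    and initial_distinct: "i \<in> {1..N} \<Longrightarrow> k \<in> {1..N} \<Longrightarrow> i \<noteq> k \<Longrightarrow> v0 i \<noteq> v0 k"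
    and solution: "aggregation_solution N m v0 v"
    and initial_mean_nonzero: "mean_vec N m v 0 \<noteq> 0"
begin

abbreviation J :: "real \<Rightarrow> 'a" where "J \<equiv> mean_vec N m v"
abbreviation \<Omega> :: "real \<Rightarrow> 'a" where "\<Omega> \<equiv> mean_dir N m v"

lemma v_initial: "i \<in> {1..N} \<Longrightarrow> v i 0 = v0 i"
  using solution by (auto simp: aggregation_solution_def)

lemma v_derivative_within:
  "i \<in> {1..N} \<Longrightarrow> t \<ge> 0 \<Longrightarrow>
    (v i has_vector_derivative proj_perp (v i t) (J t)) (at t within {0..})"
  using solution by (auto simp: aggregation_solution_def)

lemma v_derivative:
  assumes "i \<in> {1..N}" "t > 0"
  shows "(v i has_vector_derivative proj_perp (v i t) (J t)) (at t)"
  using v_derivative_within[of i t] assms at_within_interior[of t "{0..}"] by simp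

lemma v_continuous: "i \<in> {1..N} \<Longrightarrow> continuous_on {0..} (v i)"
  unfolding continuous_on_eq_continuous_within
  by (blast intro: has_vector_derivative_continuous v_derivative_within dest: atLeast_iff[THEN iffD1])

lemma J_continuous: "continuous_on {0..} J"
  unfolding mean_vec_def by (intro continuous_intros v_continuous)

text \<open>
  The defect \<open>|v i|\<^sup>2 - 1\<close> satisfies a homogeneous linear equation and vanishes initially.
\<close>

lemma norm_v:
  assumes i: "i \<in> {1..N}" and t: "t \<ge> 0"
  shows "norm (v i t) = 1"
proof -
  have "v i t \<bullet> v i t - 1 = 0"
  proof (rule linear_ode_vanishes[where y = "\<lambda>t. v i t \<bullet> v i t - 1" and k = "\<lambda>t. - 2 * (v i t \<bullet> J t)"])
    show "((\<lambda>t. v i t \<bullet> v i t - 1) has_real_derivative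
        - 2 * (v i s \<bullet> J s) * (v i s \<bullet> v i s - 1)) (at s)" if "s > 0" for s
      using has_real_derivative_inner[OF v_derivative[OF i that] v_derivative[OF i that]]
      by (auto intro!: derivative_eq_intros
          simp: proj_perp_def inner_diff_left inner_diff_right inner_commute algebra_simps)
    show "v i 0 \<bullet> v i 0 - 1 = 0"
      using v_initial[OF i] initial_unit[OF i] by (simp add: power2_norm_eq_inner[symmetric])
  qed (intro continuous_intros v_continuous J_continuous i t)+
  then show ?thesis by (simp add: norm_eq_sqrt_inner)
qed

lemma norm_J_le_one:
  assumes "t \<ge> 0"
  shows "norm (J t) \<le> 1"
proof -
  have "norm (J t) \<le> (\<Sum>i=1..N. norm (m i *\<^sub>R v i t))"
    unfolding mean_vec_def by (rule norm_sum)
  also have "\<dots> = (\<Sum>i=1..N. m i)"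
    by (rule sum.cong) (use norm_v assms mass_pos in \<open>auto simp: less_imp_le\<close>)
  finally show ?thesis by (simp only: mass_sum)
qed

abbreviation J' :: "real \<Rightarrow> 'a" where
  "J' t \<equiv> \<Sum>i=1..N. m i *\<^sub>R proj_perp (v i t) (J t)"

lemma J_derivative:
  assumes "t > 0"
  shows "(J has_vector_derivative J' t) (at t)"
  unfolding mean_vec_def[of N m v, abs_def]
  by (auto intro!: derivative_eq_intros v_derivative assms simp: mean_vec_def)

lemma norm_J'_le_one:
  assumes "t \<ge> 0"
  shows "norm (J' t) \<le> 1"
proof -
  have "norm (J' t) \<le> (\<Sum>i=1..N. norm (m i *\<^sub>R proj_perp (v i t) (J t)))"
    by (rule norm_sum)
  also have "\<dots> \<le> (\<Sum>i=1..N. m i)"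
  proof (rule sum_mono)
    fix i assume i: "i \<in> {1..N}"
    have "norm (proj_perp (v i t) (J t)) \<le> 1"
      using norm_proj_perp_le[OF norm_v[OF i assms], of "J t"] norm_J_le_one[OF assms] by simp
    with mass_pos[OF i] show "norm (m i *\<^sub>R proj_perp (v i t) (J t)) \<le> m i"
      by (simp add: mult_left_le)
  qed
  finally show ?thesis by (simp only: mass_sum)
qed

text \<open>
  Half of the rate of change of \<open>|J|\<^sup>2\<close>. Each of its terms measures how far \<open>v i\<close> is from being
  parallel to \<open>J\<close>.
\<close>

definition dissipation :: "real \<Rightarrow> real" where
  "dissipation t = (\<Sum>i=1..N. m i * ((norm (J t))\<^sup>2 - (v i t \<bullet> J t)\<^sup>2))"

lemma dissipation_term_nonneg:
  assumes "i \<in> {1..N}" "t \<ge> 0"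
  shows "(norm (J t))\<^sup>2 - (v i t \<bullet> J t)\<^sup>2 \<ge> 0"
  using norm_proj_perp_power2[OF norm_v[OF assms], of "J t"] zero_le_power2 by metis

lemma dissipation_nonneg: "t \<ge> 0 \<Longrightarrow> dissipation t \<ge> 0"
  unfolding dissipation_def using dissipation_term_nonneg mass_pos
  by (intro sum_nonneg mult_nonneg_nonneg) (auto simp: less_imp_le)

lemma norm_J_power2_derivative:
  assumes "t > 0"
  shows "((\<lambda>t. (norm (J t))\<^sup>2) has_real_derivative 2 * dissipation t) (at t)"
proof -
  have "J t \<bullet> J' t = dissipation t"
    unfolding dissipation_def inner_sum_right
    by (intro sum.cong refl)
       (simp add: proj_perp_def inner_diff_right power2_norm_eq_inner inner_commute
         power2_eq_square[of "_ \<bullet> _"])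
  then show ?thesis
    using has_real_derivative_inner[OF J_derivative[OF assms] J_derivative[OF assms]]
    by (simp add: power2_norm_eq_inner inner_commute)
qed

lemma norm_J_mono:
  assumes "0 \<le> s" "s \<le> t"
  shows "norm (J s) \<le> norm (J t)"
proof -
  have "(norm (J s))\<^sup>2 \<le> (norm (J t))\<^sup>2"
  proof (rule DERIV_nonneg_imp_increasing_open[OF assms(2)])
    show "continuous_on {s..t} (\<lambda>t. (norm (J t))\<^sup>2)"
      using assms(1) by (intro continuous_intros continuous_on_subset[OF J_continuous]) auto
    show "\<exists>y. ((\<lambda>t. (norm (J t))\<^sup>2) has_real_derivative y) (at x) \<and> 0 \<le> y"
      if "s < x" "x < t" for x
      using norm_J_power2_derivative[of x] dissipation_nonneg[of x] that assms(1) by force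
  qed
  then show ?thesis by (rule power2_le_imp_le) simp
qed

lemma norm_J_pos:
  assumes "t \<ge> 0"
  shows "norm (J t) > 0"
proof -
  have "0 < norm (J 0)" using initial_mean_nonzero by simp
  also have "\<dots> \<le> norm (J t)" using assms by (intro norm_J_mono) auto
  finally show ?thesis .
qed

lemma \<Omega>_eq: "\<Omega> t = J t /\<^sub>R norm (J t)"
  by (simp only: mean_dir_def)

lemma norm_\<Omega>: "t \<ge> 0 \<Longrightarrow> norm (\<Omega> t) = 1"
  using norm_J_pos[of t] unfolding \<Omega>_eq norm_scaleR by (simp add: abs_inverse)

lemma J_eq_norm_scaleR_\<Omega>: "J t = norm (J t) *\<^sub>R \<Omega> t"
proof (cases "J t = 0")
  case False
  then have "norm (J t) * inverse (norm (J t)) = 1" by simp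
  then show ?thesis unfolding \<Omega>_eq scaleR_scaleR by simp
qed simp

lemma dissipation_tendsto_zero: "(dissipation \<longlongrightarrow> 0) at_top"
proof -
  define E where "E t = (\<Sum>i=1..N. m i * (2 * (J t \<bullet> J' t) -
    2 * (v i t \<bullet> J t) * (v i t \<bullet> J' t + proj_perp (v i t) (J t) \<bullet> J t)))" for t
  have "((\<lambda>t. 2 * dissipation t) \<longlongrightarrow> 0) at_top"
  proof (rule bounded_increasing_derivative_tendsto_zero[OF norm_J_power2_derivative])
    fix t :: real assume t: "t > 0"
    show "2 * dissipation t \<ge> 0"
      using dissipation_nonneg[of t] t by simp
    show "(norm (J t))\<^sup>2 \<le> 1"
      using norm_J_le_one[of t] t by (simp add: power_le_one)
    have "((\<lambda>t. m i * ((norm (J t))\<^sup>2 - (v i t \<bullet> J t)\<^sup>2)) has_real_derivative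
       m i * (2 * (J t \<bullet> J' t) - 2 * (v i t \<bullet> J t) * (v i t \<bullet> J' t + proj_perp (v i t) (J t) \<bullet> J t))) (at t)"
      if i: "i \<in> {1..N}" for i
      unfolding power2_norm_eq_inner
      using has_real_derivative_inner[OF J_derivative[OF t] J_derivative[OF t]]
        has_real_derivative_inner[OF v_derivative[OF i t] J_derivative[OF t]]
      by (auto intro!: derivative_eq_intros simp: inner_commute)
    then have "(dissipation has_real_derivative E t) (at t)"
      unfolding dissipation_def[abs_def] E_def by (intro DERIV_sum) auto
    then show "((\<lambda>t. 2 * dissipation t) has_real_derivative 2 * E t) (at t)"
      by (rule DERIV_cmult)
    \<comment> \<open>All vectors involved have norm at most 1, so the first inner product contributes at least -2
      and the product of the other two at least -4.\<close>
    have "E t \<ge> (\<Sum>i=1..N. m i * - 6)"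
      unfolding E_def
    proof (intro sum_mono mult_left_mono)
      fix i assume i: "i \<in> {1..N}"
      have bnd: "\<bar>x \<bullet> y\<bar> \<le> 1" if "norm x \<le> 1" "norm y \<le> 1" for x y :: 'a
        using Cauchy_Schwarz_ineq2[of x y] mult_le_one[OF that(1) _ that(2)] by simp
      have n: "norm (v i t) \<le> 1" "norm (J t) \<le> 1" "norm (J' t) \<le> 1"
        "norm (proj_perp (v i t) (J t)) \<le> 1"
        using norm_v[of i t] i t norm_J_le_one[of t] norm_J'_le_one[of t]
          norm_proj_perp_le[of "v i t" "J t"] by auto
      have "\<bar>(v i t \<bullet> J t) * (v i t \<bullet> J' t + proj_perp (v i t) (J t) \<bullet> J t)\<bar> \<le> 1 * 2"
        unfolding abs_mult
        using bnd[OF n(1,2)] bnd[OF n(1,3)] bnd[OF n(4,2)] by (intro mult_mono) auto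
      then show "- 6 \<le> 2 * (J t \<bullet> J' t) -
          2 * (v i t \<bullet> J t) * (v i t \<bullet> J' t + proj_perp (v i t) (J t) \<bullet> J t)"
        using bnd[OF n(2,3)] by (simp add: abs_le_iff)
    qed (use mass_pos in \<open>auto simp: less_imp_le\<close>)
    also have "(\<Sum>i=1..N. m i * - 6) = - 6"
      by (simp only: mass_sum flip: sum_distrib_right)
    finally show "2 * E t \<ge> - 12" by simp
  qed
  from tendsto_mult_left[OF this, of "1/2"] show ?thesis by simp
qed

definition c :: "nat \<Rightarrow> real \<Rightarrow> real" where
  "c i t = v i t \<bullet> \<Omega> t"

definition y :: "nat \<Rightarrow> real \<Rightarrow> 'a" where
  "y i t = proj_perp (\<Omega> t) (v i t)"

lemma v_decomp: "v i t = c i t *\<^sub>R \<Omega> t + y i t"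
  by (simp add: y_def c_def proj_perp_def inner_commute)

lemma y_orthogonal: "t \<ge> 0 \<Longrightarrow> \<Omega> t \<bullet> y i t = 0"
  by (simp add: y_def inner_proj_perp_self norm_\<Omega>)

lemma norm_y_power2: "i \<in> {1..N} \<Longrightarrow> t \<ge> 0 \<Longrightarrow> (norm (y i t))\<^sup>2 = 1 - (c i t)\<^sup>2"
  by (simp add: y_def c_def norm_proj_perp_power2 norm_\<Omega> norm_v inner_commute)

lemma abs_c_le_one: "i \<in> {1..N} \<Longrightarrow> t \<ge> 0 \<Longrightarrow> \<bar>c i t\<bar> \<le> 1"
  using norm_y_power2[of i t] zero_le_power2[of "norm (y i t)"]
  by (simp add: abs_square_le_1)

lemma norm_y_le_one: "i \<in> {1..N} \<Longrightarrow> t \<ge> 0 \<Longrightarrow> norm (y i t) \<le> 1"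
  using norm_proj_perp_le[of "\<Omega> t" "v i t"] by (simp add: y_def norm_\<Omega> norm_v)

text \<open>
  The \<open>y i\<close> are the projections of the \<open>v i\<close> orthogonally to \<open>\<Omega>\<close>, and their mean is the projection
  of \<open>J\<close>, which is parallel to \<open>\<Omega>\<close>.
\<close>

lemma sum_y_eq_zero:
  assumes "t \<ge> 0"
  shows "(\<Sum>i=1..N. m i *\<^sub>R y i t) = 0"
proof -
  have "(\<Sum>i=1..N. m i *\<^sub>R y i t) = proj_perp (\<Omega> t) (J t)"
    by (simp add: y_def mean_vec_def proj_perp_sum proj_perp_scaleR)
  also have "\<dots> = 0"
    by (subst J_eq_norm_scaleR_\<Omega>) (simp add: proj_perp_scaleR proj_perp_self norm_\<Omega> assms)
  finally show ?thesis .
qed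

lemma norm_J_eq_sum_c:
  assumes "t \<ge> 0"
  shows "norm (J t) = (\<Sum>i=1..N. m i * c i t)"
proof -
  have "(\<Sum>i=1..N. m i * c i t) = J t \<bullet> \<Omega> t"
    by (simp add: c_def mean_vec_def inner_sum_left)
  also have "\<dots> = norm (J t)"
    by (subst J_eq_norm_scaleR_\<Omega>) (simp add: norm_\<Omega>[OF assms] power2_norm_eq_inner[symmetric])
  finally show ?thesis ..
qed

text \<open>
  This is the derivative of \<open>\<Omega>\<close>. The factor \<open>1 - c i\<close>, in place of the \<open>- c i\<close> that comes out of the
  computation, is obtained from \<open>sum_y_eq_zero\<close>; it makes the contribution of the aligned vectors cubic.
\<close>

definition drift :: "real \<Rightarrow> 'a" where
  "drift t = (\<Sum>i=1..N. (m i * (1 - c i t)) *\<^sub>R y i t)"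

lemma proj_perp_v_J: "proj_perp (v i t) (J t) = norm (J t) *\<^sub>R (\<Omega> t - c i t *\<^sub>R v i t)"
proof -
  have "proj_perp (v i t) (J t) = proj_perp (v i t) (norm (J t) *\<^sub>R \<Omega> t)"
    by (simp only: J_eq_norm_scaleR_\<Omega>[symmetric])
  also have "\<dots> = norm (J t) *\<^sub>R (\<Omega> t - c i t *\<^sub>R v i t)"
    unfolding proj_perp_scaleR by (simp add: proj_perp_def c_def)
  finally show ?thesis .
qed

lemma v_derivative_polar:
  assumes "i \<in> {1..N}" "t > 0"
  shows "(v i has_vector_derivative norm (J t) *\<^sub>R (\<Omega> t - c i t *\<^sub>R v i t)) (at t)"
  using v_derivative[OF assms] by (simp only: proj_perp_v_J)

lemma \<Omega>_derivative:
  assumes t: "t > 0"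
  shows "(\<Omega> has_vector_derivative drift t) (at t)"
proof -
  have t0: "t \<ge> 0" using t by simp
  have "J' t = (\<Sum>i=1..N. (m i * norm (J t)) *\<^sub>R (\<Omega> t - c i t *\<^sub>R v i t))"
    by (simp add: proj_perp_v_J)
  then have "proj_perp (\<Omega> t) (J' t) = (\<Sum>i=1..N. - (m i * norm (J t) * c i t) *\<^sub>R y i t)"
    by (simp add: proj_perp_sum proj_perp_scaleR proj_perp_diff proj_perp_self norm_\<Omega>[OF t0] y_def[symmetric])
  then have "proj_perp (\<Omega> t) (J' t) /\<^sub>R norm (J t) = (\<Sum>i=1..N. - (m i * c i t) *\<^sub>R y i t)"
    using norm_J_pos[OF t0] by (simp add: scaleR_sum_right field_simps)
  also have "\<dots> = drift t"
    using sum_y_eq_zero[OF t0]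
    by (simp add: drift_def right_diff_distrib scaleR_diff_left sum_subtractf sum_negf)
  finally have eq: "proj_perp (\<Omega> t) (J' t) /\<^sub>R norm (J t) = drift t" .
  have "J t \<noteq> 0" using norm_J_pos[OF t0] by auto
  from has_vector_derivative_direction[OF J_derivative[OF t] this] show ?thesis
    by (simp only: \<Omega>_eq[symmetric] eq)
qed

lemma drift_orthogonal: "t \<ge> 0 \<Longrightarrow> \<Omega> t \<bullet> drift t = 0"
  by (simp add: drift_def inner_sum_right y_orthogonal)

lemma c_derivative:
  assumes i: "i \<in> {1..N}" and t: "t > 0"
  shows "(c i has_real_derivative norm (J t) * (1 - (c i t)\<^sup>2) + y i t \<bullet> drift t) (at t)"
proof -
  have "v i t \<bullet> drift t = (c i t *\<^sub>R \<Omega> t + y i t) \<bullet> drift t"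
    by (simp only: v_decomp[symmetric])
  then have "v i t \<bullet> drift t = y i t \<bullet> drift t"
    using t by (simp add: inner_add_left drift_orthogonal)
  moreover have "(\<Omega> t - c i t *\<^sub>R v i t) \<bullet> \<Omega> t = 1 - (c i t)\<^sup>2"
    using t norm_\<Omega>[of t]
    by (simp add: inner_diff_left c_def[symmetric] power2_norm_eq_inner[symmetric] power2_eq_square[of "c i t"])
  ultimately have "norm (J t) * (1 - (c i t)\<^sup>2) + y i t \<bullet> drift t =
      v i t \<bullet> drift t + (norm (J t) *\<^sub>R (\<Omega> t - c i t *\<^sub>R v i t)) \<bullet> \<Omega> t"
    by simp
  then show ?thesis
    using has_real_derivative_inner[OF v_derivative_polar[OF i t] \<Omega>_derivative[OF t]]
    by (simp add: c_def[abs_def])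
qed

lemma norm_y_power2_derivative:
  assumes i: "i \<in> {1..N}" and t: "t > 0"
  shows "((\<lambda>t. (norm (y i t))\<^sup>2) has_real_derivative
    - 2 * c i t * (norm (J t) * (norm (y i t))\<^sup>2 + y i t \<bullet> drift t)) (at t)"
proof -
  have "((\<lambda>t. 1 - (c i t)\<^sup>2) has_real_derivative
    - 2 * c i t * (norm (J t) * (1 - (c i t)\<^sup>2) + y i t \<bullet> drift t)) (at t)"
    by (auto intro!: derivative_eq_intros c_derivative i t)
  then have "((\<lambda>t. 1 - (c i t)\<^sup>2) has_real_derivative
    - 2 * c i t * (norm (J t) * (norm (y i t))\<^sup>2 + y i t \<bullet> drift t)) (at t)"
    using norm_y_power2[of i t] i t by simp
  then show ?thesis
  proof (rule has_field_derivative_transform_within_open)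
    show "1 - (c i s)\<^sup>2 = (norm (y i s))\<^sup>2" if "s \<in> {0<..}" for s
      using norm_y_power2[of i s] i that by simp
  qed (use t in auto)
qed

lemma y_derivative:
  assumes i: "i \<in> {1..N}" and t: "t > 0"
  shows "(y i has_vector_derivative
    - (norm (J t) * c i t) *\<^sub>R y i t - (y i t \<bullet> drift t) *\<^sub>R \<Omega> t - c i t *\<^sub>R drift t) (at t)"
proof -
  have "((\<lambda>t. v i t - c i t *\<^sub>R \<Omega> t) has_vector_derivative
     norm (J t) *\<^sub>R (\<Omega> t - c i t *\<^sub>R v i t) - (c i t *\<^sub>R drift t +
       (norm (J t) * (1 - (c i t)\<^sup>2) + y i t \<bullet> drift t) *\<^sub>R \<Omega> t)) (at t)"
    by (intro has_vector_derivative_diff has_vector_derivative_scaleR v_derivative_polar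
        c_derivative \<Omega>_derivative i t)
  moreover have "(\<lambda>t. v i t - c i t *\<^sub>R \<Omega> t) = y i"
    using v_decomp[of i] by (intro ext) (metis add_diff_cancel_left')
  moreover have "norm (J t) *\<^sub>R (\<Omega> t - c i t *\<^sub>R v i t) - (c i t *\<^sub>R drift t +
       (norm (J t) * (1 - (c i t)\<^sup>2) + y i t \<bullet> drift t) *\<^sub>R \<Omega> t) =
    - (norm (J t) * c i t) *\<^sub>R y i t - (y i t \<bullet> drift t) *\<^sub>R \<Omega> t - c i t *\<^sub>R drift t"
    by (subst v_decomp) (simp add: algebra_simps power2_eq_square)
  ultimately show ?thesis by simp
qed

lemma c_continuous: "i \<in> {1..N} \<Longrightarrow> continuous_on {0<..} (c i)"
  by (intro continuous_at_imp_continuous_on ballI DERIV_isCont[OF c_derivative]) auto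

text \<open>
  The dissipation controls \<open>m i |J|\<^sup>2 (1 - (c i)\<^sup>2)\<close>, and \<open>|J|\<close> stays above its positive initial value.
\<close>

lemma c_power2_tendsto_one:
  assumes i: "i \<in> {1..N}"
  shows "((\<lambda>t. (c i t)\<^sup>2) \<longlongrightarrow> 1) at_top"
proof -
  have "((\<lambda>t. dissipation t / (m i * (norm (J 0))\<^sup>2)) \<longlongrightarrow> 0 / (m i * (norm (J 0))\<^sup>2)) at_top"
    using mass_pos[OF i] initial_mean_nonzero by (intro tendsto_intros dissipation_tendsto_zero) auto
  then have lim: "((\<lambda>t. dissipation t / (m i * (norm (J 0))\<^sup>2)) \<longlongrightarrow> 0) at_top" by simp
  have "norm (1 - (c i t)\<^sup>2) \<le> dissipation t / (m i * (norm (J 0))\<^sup>2)" if t: "t \<ge> 0" for t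
  proof -
    have "(norm (J t))\<^sup>2 - (v i t \<bullet> J t)\<^sup>2 = (norm (J t))\<^sup>2 * (1 - (c i t)\<^sup>2)"
    proof -
      have "v i t \<bullet> J t = v i t \<bullet> (norm (J t) *\<^sub>R \<Omega> t)"
        by (simp only: J_eq_norm_scaleR_\<Omega>[symmetric])
      then have "v i t \<bullet> J t = norm (J t) * c i t"
        by (simp add: c_def)
      then show ?thesis by (simp add: power_mult_distrib right_diff_distrib)
    qed
    then have "m i * ((norm (J t))\<^sup>2 * (1 - (c i t)\<^sup>2)) \<le> dissipation t"
      unfolding dissipation_def
      using member_le_sum[OF i, of "\<lambda>i. m i * ((norm (J t))\<^sup>2 - (v i t \<bullet> J t)\<^sup>2)"]
        dissipation_term_nonneg mass_pos t by (simp add: less_imp_le)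
    moreover have "(norm (J 0))\<^sup>2 * (1 - (c i t)\<^sup>2) \<le> (norm (J t))\<^sup>2 * (1 - (c i t)\<^sup>2)"
      using norm_J_mono[of 0 t] t abs_c_le_one[OF i t]
      by (intro mult_right_mono power_mono) (auto simp: abs_square_le_1)
    ultimately have "m i * ((norm (J 0))\<^sup>2 * (1 - (c i t)\<^sup>2)) \<le> dissipation t"
      using mass_pos[OF i] by (meson less_imp_le mult_left_mono order_trans)
    then show ?thesis
      using mass_pos[OF i] initial_mean_nonzero abs_c_le_one[OF i t]
      by (simp add: pos_le_divide_eq abs_square_le_1 mult_ac)
  qed
  then have "((\<lambda>t. 1 - (c i t)\<^sup>2) \<longlongrightarrow> 0) at_top"
    by (intro Lim_null_comparison[OF _ lim] eventually_at_top_linorderI[of 0]) simp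
  from tendsto_diff[OF tendsto_const[of 1] this] show ?thesis by simp
qed

section \<open>At most one vector is opposed to the mean direction\<close>

lemma c_add_c_bound:
  assumes "i \<in> {1..N}" "k \<in> {1..N}" "t \<ge> 0"
  shows "norm (J t) * (c i t + c k t) \<le> 2"
proof -
  have "norm (J t) * (c i t + c k t) \<le> norm (J t) * 2"
    using abs_c_le_one[OF assms(1,3)] abs_c_le_one[OF assms(2,3)] by (intro mult_left_mono) auto
  with norm_J_le_one[OF assms(3)] show ?thesis by linarith
qed

lemma separation_derivative:
  assumes i: "i \<in> {1..N}" and k: "k \<in> {1..N}" and t: "t > 0"
  shows "((\<lambda>t. 1 - v i t \<bullet> v k t) has_real_derivative
    - (norm (J t) * (c i t + c k t)) * (1 - v i t \<bullet> v k t)) (at t)"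
proof -
  have "v i t \<bullet> (norm (J t) *\<^sub>R (\<Omega> t - c k t *\<^sub>R v k t)) +
      (norm (J t) *\<^sub>R (\<Omega> t - c i t *\<^sub>R v i t)) \<bullet> v k t =
      norm (J t) * (c i t + c k t) * (1 - v i t \<bullet> v k t)"
    by (simp add: inner_diff_left inner_diff_right c_def inner_commute[of "\<Omega> t" "v k t"] algebra_simps)
  with has_real_derivative_inner[OF v_derivative_polar[OF i t] v_derivative_polar[OF k t]]
  have "((\<lambda>t. v i t \<bullet> v k t) has_real_derivative
      norm (J t) * (c i t + c k t) * (1 - v i t \<bullet> v k t)) (at t)"
    by simp
  from DERIV_diff[OF DERIV_const[of 1] this] show ?thesis by simp
qed

lemma separation_nonneg:
  assumes "i \<in> {1..N}" "k \<in> {1..N}" "t \<ge> 0"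
  shows "1 - v i t \<bullet> v k t \<ge> 0"
  using Cauchy_Schwarz_ineq2[of "v i t" "v k t"] assms by (simp add: norm_v)

lemma norm_v_diff_power2:
  assumes "i \<in> {1..N}" "k \<in> {1..N}" "t \<ge> 0"
  shows "(norm (v i t - v k t))\<^sup>2 = 2 * (1 - v i t \<bullet> v k t)"
proof -
  have "v i t \<bullet> v i t = 1" "v k t \<bullet> v k t = 1"
    using norm_v assms by (simp_all add: power2_norm_eq_inner[symmetric])
  then show ?thesis
    by (simp add: power2_norm_eq_inner inner_diff_left inner_diff_right inner_commute[of "v k t" "v i t"])
qed

lemma separation_continuous:
  assumes "i \<in> {1..N}" "k \<in> {1..N}" "s \<ge> 0"
  shows "continuous_on {s..t} (\<lambda>t. 1 - v i t \<bullet> v k t)"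
  by (intro continuous_intros continuous_on_subset[OF v_continuous]) (use assms in auto)

text \<open>
  The separation obeys a linear equation with a coefficient bounded by 2, so distinct initial
  vectors do not meet in finite time.
\<close>

lemma separation_pos:
  assumes i: "i \<in> {1..N}" and k: "k \<in> {1..N}" and "i \<noteq> k" and t: "t \<ge> 0"
  shows "1 - v i t \<bullet> v k t > 0"
proof -
  have "v i 0 \<noteq> v k 0"
    using initial_distinct[OF i k \<open>i \<noteq> k\<close>] v_initial i k by simp
  then have "(norm (v i 0 - v k 0))\<^sup>2 > 0" by simp
  then have "0 < exp (- 2 * (t - 0)) * (1 - v i 0 \<bullet> v k 0)"
    using norm_v_diff_power2[OF i k, of 0] by simp
  also have "\<dots> \<le> 1 - v i t \<bullet> v k t"
  proof (rule gronwall_lower[OF t separation_continuous[OF i k order_refl]])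
    fix s assume s: "0 < s" "s < t"
    show "((\<lambda>t. 1 - v i t \<bullet> v k t) has_real_derivative
      - (norm (J s) * (c i s + c k s)) * (1 - v i s \<bullet> v k s)) (at s)"
      by (rule separation_derivative[OF i k s(1)])
    show "- 2 * (1 - v i s \<bullet> v k s) \<le> - (norm (J s) * (c i s + c k s)) * (1 - v i s \<bullet> v k s)"
      using separation_nonneg[OF i k, of s] c_add_c_bound[OF i k, of s] s
      by (intro mult_right_mono) auto
  qed
  finally show ?thesis .
qed

definition aligned :: "nat set" where
  "aligned = {i \<in> {1..N}. (c i \<longlongrightarrow> 1) at_top}"

definition opposed :: "nat set" where
  "opposed = {i \<in> {1..N}. (c i \<longlongrightarrow> - 1) at_top}"

text \<open>
  The limit of \<open>|J|\<close>, hence the linear rate at which aligned vectors approach \<open>\<Omega>\<close>.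
\<close>

definition lam :: real where
  "lam = (\<Sum>i\<in>aligned. m i) - (\<Sum>i\<in>opposed. m i)"

lemma aligned_index: "i \<in> aligned \<Longrightarrow> i \<in> {1..N}"
  and aligned_tendsto: "i \<in> aligned \<Longrightarrow> (c i \<longlongrightarrow> 1) at_top"
  and opposed_index: "i \<in> opposed \<Longrightarrow> i \<in> {1..N}"
  and opposed_tendsto: "i \<in> opposed \<Longrightarrow> (c i \<longlongrightarrow> - 1) at_top"
  by (simp_all add: aligned_def opposed_def)

lemma finite_aligned: "finite aligned" and finite_opposed: "finite opposed"
  by (simp_all add: aligned_def opposed_def)

lemma aligned_Un_opposed: "aligned \<union> opposed = {1..N}"
proof
  show "{1..N} \<subseteq> aligned \<union> opposed"
    using tendsto_one_or_minus_one[OF c_power2_tendsto_one c_continuous]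
    unfolding aligned_def opposed_def by blast
qed (auto simp: aligned_def opposed_def)

lemma aligned_Int_opposed: "aligned \<inter> opposed = {}"
proof -
  have False if "(c i \<longlongrightarrow> 1) at_top" "(c i \<longlongrightarrow> - 1) at_top" for i
    using tendsto_unique[OF trivial_limit_at_top_linorder that] by simp
  then show ?thesis by (auto simp: aligned_def opposed_def)
qed

lemma sum_split: "(\<Sum>i=1..N. f i) = (\<Sum>i\<in>aligned. f i) + (\<Sum>i\<in>opposed. f i)"
  for f :: "nat \<Rightarrow> 'b::comm_monoid_add"
  unfolding aligned_Un_opposed[symmetric]
  by (rule sum.union_disjoint[OF finite_aligned finite_opposed aligned_Int_opposed])

lemma norm_J_tendsto_lam: "((\<lambda>t. norm (J t)) \<longlongrightarrow> lam) at_top"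
proof -
  have "((\<lambda>t. (\<Sum>i\<in>aligned. m i * c i t) + (\<Sum>i\<in>opposed. m i * c i t)) \<longlongrightarrow>
      (\<Sum>i\<in>aligned. m i * 1) + (\<Sum>i\<in>opposed. m i * - 1)) at_top"
    by (intro tendsto_add tendsto_sum tendsto_mult tendsto_const aligned_tendsto opposed_tendsto)
  moreover have "eventually (\<lambda>t. (\<Sum>i\<in>aligned. m i * c i t) + (\<Sum>i\<in>opposed. m i * c i t) = norm (J t)) at_top"
    by (intro eventually_at_top_linorderI[of 0]) (simp only: norm_J_eq_sum_c sum_split)
  ultimately show ?thesis
    by (simp add: lam_def sum_negf tendsto_cong)
qed

text \<open>
  The limit of \<open>|J|\<close> is at least its initial value.
\<close>

lemma lam_pos: "lam > 0"
proof -
  have "norm (J 0) \<le> lam"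
    using norm_J_tendsto_lam
    by (rule tendsto_lowerbound) (auto intro!: eventually_at_top_linorderI[of 0] norm_J_mono)
  moreover have "norm (J 0) > 0" using initial_mean_nonzero by simp
  ultimately show ?thesis by linarith
qed

lemma y_tendsto_zero:
  assumes "i \<in> {1..N}"
  shows "(y i \<longlongrightarrow> 0) at_top"
proof -
  have "((\<lambda>t. sqrt (1 - (c i t)\<^sup>2)) \<longlongrightarrow> sqrt (1 - 1)) at_top"
    by (intro tendsto_intros c_power2_tendsto_one assms)
  moreover have "eventually (\<lambda>t. sqrt (1 - (c i t)\<^sup>2) = norm (y i t)) at_top"
    by (intro eventually_at_top_linorderI[of 0]) (simp add: norm_y_power2[OF assms, symmetric])
  ultimately have "((\<lambda>t. norm (y i t)) \<longlongrightarrow> 0) at_top"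
    by (simp add: tendsto_cong)
  then show ?thesis by (rule tendsto_norm_zero_cancel)
qed

lemma inner_v_eq:
  assumes "t \<ge> 0"
  shows "v i t \<bullet> v k t = c i t * c k t + y i t \<bullet> y k t"
proof -
  have "\<Omega> t \<bullet> \<Omega> t = 1" "y i t \<bullet> \<Omega> t = 0" "\<Omega> t \<bullet> y k t = 0"
    using norm_\<Omega>[OF assms] y_orthogonal[OF assms]
    by (simp_all add: power2_norm_eq_inner[symmetric] inner_commute[of "y i t"])
  then have "(c i t *\<^sub>R \<Omega> t + y i t) \<bullet> (c k t *\<^sub>R \<Omega> t + y k t) = c i t * c k t + y i t \<bullet> y k t"
    by (simp add: inner_add_left inner_add_right)
  then show ?thesis by (simp only: v_decomp[symmetric])
qed

text \<open>
  Two opposed vectors would converge to each other, while their separation, whose growth rate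
  \<open>- |J| (c i + c k)\<close> becomes positive, eventually increases from a positive value.
\<close>

lemma opposed_unique:
  assumes i: "i \<in> opposed" and k: "k \<in> opposed"
  shows "i = k"
proof (rule ccontr)
  assume "i \<noteq> k"
  note ik = opposed_index[OF i] opposed_index[OF k]
  have "((\<lambda>t. c i t + c k t) \<longlongrightarrow> - 1 + - 1) at_top"
    by (intro tendsto_intros opposed_tendsto i k)
  then have "eventually (\<lambda>t. c i t + c k t < 0) at_top"
    by (rule order_tendstoD(2)) simp
  from eventually_conj[OF this eventually_gt_at_top[of 0]] obtain T where
    T: "\<And>t. t \<ge> T \<Longrightarrow> c i t + c k t < 0 \<and> t > 0"
    unfolding eventually_at_top_linorder by auto
  have T0: "T > 0" using T[of T] by simp
  have "((\<lambda>t. 1 - (c i t * c k t + y i t \<bullet> y k t)) \<longlongrightarrow> 1 - (- 1 * - 1 + 0 \<bullet> (0::'a))) at_top"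
    by (intro tendsto_intros opposed_tendsto y_tendsto_zero i k ik)
  moreover have "eventually (\<lambda>t. 1 - (c i t * c k t + y i t \<bullet> y k t) = 1 - v i t \<bullet> v k t) at_top"
    by (intro eventually_at_top_linorderI[of 0]) (simp add: inner_v_eq)
  ultimately have lim: "((\<lambda>t. 1 - v i t \<bullet> v k t) \<longlongrightarrow> 0) at_top"
    by (simp add: tendsto_cong)
  have "1 - v i t \<bullet> v k t \<ge> exp (0 * (t - T)) * (1 - v i T \<bullet> v k T)" if "t \<ge> T" for t
  proof (rule gronwall_lower[OF that separation_continuous[OF ik]])
    fix s assume s: "T < s" "s < t"
    then show "((\<lambda>t. 1 - v i t \<bullet> v k t) has_real_derivative
      - (norm (J s) * (c i s + c k s)) * (1 - v i s \<bullet> v k s)) (at s)"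
      using T0 by (intro separation_derivative[OF ik]) simp
    have "norm (J s) * (c i s + c k s) \<le> 0"
      using T[of s] s by (intro mult_nonneg_nonpos) auto
    then show "0 * (1 - v i s \<bullet> v k s) \<le> - (norm (J s) * (c i s + c k s)) * (1 - v i s \<bullet> v k s)"
      using separation_nonneg[OF ik, of s] T[of s] s by (intro mult_right_mono) auto
  qed (use T0 in simp)
  then have "1 - v i T \<bullet> v k T \<le> 0"
    by (intro tendsto_lowerbound[OF lim] eventually_at_top_linorderI[of T]) auto
  with separation_pos[OF ik \<open>i \<noteq> k\<close>, of T] T0 show False by simp
qed

lemma opposed_eq_singleton: "b \<in> opposed \<Longrightarrow> opposed = {b}"
  using opposed_unique by blast

section \<open>A first decay rate\<close>

text \<open>
  The separation decreases at a rate that tends to \<open>2 lam\<close>, hence eventually exceeds \<open>lam\<close>. Half of the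
  true rate is enough for the later improvement, and the separation is half of the squared distance.
\<close>

lemma aligned_difference_decays:
  assumes i: "i \<in> aligned" and k: "k \<in> aligned"
  shows "decays (lam / 2) (\<lambda>t. v i t - v k t)"
proof -
  note ik = aligned_index[OF i] aligned_index[OF k]
  have "((\<lambda>t. norm (J t) * (c i t + c k t)) \<longlongrightarrow> lam * (1 + 1)) at_top"
    by (intro tendsto_intros norm_J_tendsto_lam aligned_tendsto i k)
  then have "eventually (\<lambda>t. norm (J t) * (c i t + c k t) > lam) at_top"
    by (rule order_tendstoD(1)) (use lam_pos in simp)
  then have "eventually (\<lambda>t. norm (J t) * (c i t + c k t) \<ge> lam) at_top"
    by eventually_elim simp
  then have "decays lam (\<lambda>t. 1 - v i t \<bullet> v k t)"
    by (intro stable_decays[OF separation_derivative[OF ik]] separation_nonneg ik) auto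
  then have "decays lam (\<lambda>t. (norm (v i t - v k t))\<^sup>2)"
    by (rule decays_le[of _ _ _ 2])
       (use separation_nonneg[OF ik] in
         \<open>auto intro!: eventually_at_top_linorderI[of 0] simp: norm_v_diff_power2[OF ik]\<close>)
  then have "decays (2 * (lam / 2)) (\<lambda>t. (norm (v i t - v k t))\<^sup>2)"
    by simp
  then show ?thesis by (simp only: decays_norm_power2_iff)
qed

text \<open>
  The part of \<open>drift\<close> that acts as a forcing on an opposed vector. The other part, its own
  contribution, only strengthens the repulsion.
\<close>

definition aligned_drift :: "real \<Rightarrow> 'a" where
  "aligned_drift t = (\<Sum>i\<in>aligned. (m i * (1 - c i t)) *\<^sub>R y i t)"

lemma drift_eq: "drift t = aligned_drift t + (\<Sum>i\<in>opposed. (m i * (1 - c i t)) *\<^sub>R y i t)"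
  unfolding drift_def aligned_drift_def by (rule sum_split)

text \<open>
  Near \<open>- \<Omega>\<close> the equation for \<open>y b\<close> is unstable: the growth rate of \<open>|y b|\<^sup>2\<close> is at least
  \<open>- 2 c b |J|\<close>, which tends to \<open>2 lam\<close>. As \<open>y b\<close> is bounded, it is not larger than its forcing. A forcing that is partly
  proportional to \<open>|y b|\<close> is harmless if the factor is small; this is needed for the first decay
  rate, where the aligned vectors are only controlled in terms of \<open>y b\<close>.
\<close>

lemma opposed_decays:
  fixes h :: "real \<Rightarrow> real"
  assumes b: "b \<in> opposed" and h: "decays r h" and r: "r \<ge> 0"
    and bound: "eventually (\<lambda>t. norm (aligned_drift t) \<le> lam / 8 * norm (y b t) + h t) at_top"
  shows "decays r (y b)"
proof -
  note bi = opposed_index[OF b]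
  have "((\<lambda>t. - 2 * c b t * norm (J t)) \<longlongrightarrow> - 2 * - 1 * lam) at_top"
    by (intro tendsto_intros norm_J_tendsto_lam opposed_tendsto b)
  then have ev1: "eventually (\<lambda>t. - 2 * c b t * norm (J t) > lam) at_top"
    by (rule order_tendstoD(1)) (use lam_pos in simp)
  have ev2: "eventually (\<lambda>t. c b t < 0) at_top"
    by (rule order_tendstoD(2)[OF opposed_tendsto[OF b]]) simp
  have "decays (2 * r) (\<lambda>t. (norm (y b t))\<^sup>2)"
  proof (rule bounded_unstable_decays[OF norm_y_power2_derivative[OF bi]])
    show "(norm (y b t))\<^sup>2 \<le> 1" if "t > 0" for t
      using norm_y_le_one[OF bi, of t] that by (simp add: power_le_one)
    show "decays (2 * r) (\<lambda>t. (4 / lam) *\<^sub>R (norm (h t))\<^sup>2)"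
      by (intro decays_cmult) (simp only: decays_norm_power2_iff h)
    show "lam / 2 > 0" using lam_pos by simp
    show "eventually (\<lambda>t. lam / 2 * (norm (y b t))\<^sup>2 - (4 / lam) *\<^sub>R (norm (h t))\<^sup>2 \<le>
        - 2 * c b t * (norm (J t) * (norm (y b t))\<^sup>2 + y b t \<bullet> drift t)) at_top"
      using ev1 ev2 bound eventually_ge_at_top[of 0]
    proof eventually_elim
      case (elim t)
      let ?q = "norm (y b t)" and ?C = "- 2 * c b t"
      have cb: "\<bar>c b t\<bar> \<le> 1" by (rule abs_c_le_one[OF bi elim(4)])
      have C: "0 \<le> ?C" "?C \<le> 2" using elim(2) cb by auto
      have "y b t \<bullet> drift t = y b t \<bullet> aligned_drift t + m b * (1 - c b t) * ?q\<^sup>2"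
        by (simp add: drift_eq opposed_eq_singleton[OF b] inner_add_right power2_norm_eq_inner)
      moreover have "m b * (1 - c b t) * ?q\<^sup>2 \<ge> 0"
        using mass_pos[OF bi] elim(2) by simp
      moreover have "y b t \<bullet> aligned_drift t \<ge> - (?q * norm (aligned_drift t))"
        using Cauchy_Schwarz_ineq2[of "y b t" "aligned_drift t"] by linarith
      ultimately have "y b t \<bullet> drift t \<ge> - (?q * norm (aligned_drift t))"
        by linarith
      moreover have "?q * norm (aligned_drift t) \<le> ?q * (lam / 8 * ?q + \<bar>h t\<bar>)"
        using elim(3) by (intro mult_left_mono) auto
      ultimately have "y b t \<bullet> drift t \<ge> - (?q * (lam / 8 * ?q + \<bar>h t\<bar>))"
        by linarith
      from mult_left_mono[OF this C(1)]
      have A: "?C * (y b t \<bullet> drift t) \<ge> - (?C * (?q * (lam / 8 * ?q + \<bar>h t\<bar>)))"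
        by simp
      have "?q * (lam / 8 * ?q + \<bar>h t\<bar>) \<ge> 0"
        using lam_pos by simp
      from mult_right_mono[OF C(2) this]
      have B: "?C * (?q * (lam / 8 * ?q + \<bar>h t\<bar>)) \<le> 2 * (?q * (lam / 8 * ?q + \<bar>h t\<bar>))" .
      \<comment> \<open>Of the growth rate \<open>lam\<close>, one quarter absorbs the part \<open>lam / 8\<close> of the forcing (which
        enters with a factor 2) and another quarter the cross term with \<open>h\<close>.\<close>
      have D: "2 * (?q * \<bar>h t\<bar>) \<le> lam / 4 * ?q\<^sup>2 + 4 / lam * (h t)\<^sup>2"
      proof -
        have "0 \<le> (lam / 4 * ?q - \<bar>h t\<bar>)\<^sup>2 * (4 / lam)"
          using lam_pos by simp
        also have "\<dots> = lam / 4 * ?q\<^sup>2 + 4 / lam * (h t)\<^sup>2 - 2 * (?q * \<bar>h t\<bar>)"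
          using lam_pos by (simp add: power2_eq_square field_simps)
        finally show ?thesis by simp
      qed
      have E: "(?C * norm (J t)) * ?q\<^sup>2 \<ge> lam * ?q\<^sup>2"
        using elim(1) by (intro mult_right_mono) auto
      have F: "2 * (?q * (lam / 8 * ?q + \<bar>h t\<bar>)) = lam / 4 * ?q\<^sup>2 + 2 * (?q * \<bar>h t\<bar>)"
        by (simp add: power2_eq_square algebra_simps)
      have "?C * (norm (J t) * ?q\<^sup>2 + y b t \<bullet> drift t) =
          (?C * norm (J t)) * ?q\<^sup>2 + ?C * (y b t \<bullet> drift t)"
        by (simp add: algebra_simps)
      then have "?C * (norm (J t) * ?q\<^sup>2 + y b t \<bullet> drift t) \<ge>
          lam * ?q\<^sup>2 - (lam / 4 * ?q\<^sup>2 + (lam / 4 * ?q\<^sup>2 + 4 / lam * (h t)\<^sup>2))"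
        using A B D E F by linarith
      moreover have "lam * ?q\<^sup>2 - (lam / 4 * ?q\<^sup>2 + (lam / 4 * ?q\<^sup>2 + 4 / lam * (h t)\<^sup>2)) =
          lam / 2 * ?q\<^sup>2 - (4 / lam) *\<^sub>R (norm (h t))\<^sup>2"
        by (simp add: algebra_simps)
      ultimately show ?case by linarith
    qed
  qed (use r in auto)
  then show ?thesis by (simp only: decays_norm_power2_iff)
qed

lemma aligned_mass_pos: "(\<Sum>i\<in>aligned. m i) > 0"
proof -
  have "(\<Sum>i\<in>opposed. m i) \<ge> 0"
    by (intro sum_nonneg less_imp_le mass_pos opposed_index)
  with lam_pos show ?thesis by (simp add: lam_def)
qed

lemma aligned_mass_le_one: "(\<Sum>i\<in>aligned. m i) \<le> 1"
proof -
  have "(\<Sum>i\<in>opposed. m i) \<ge> 0"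
    by (intro sum_nonneg less_imp_le mass_pos opposed_index)
  with sum_split[of m] mass_sum show ?thesis by linarith
qed

text \<open>
  Aligned vectors approach each other at rate \<open>lam / 2\<close>, so their projections agree up to such an
  error. By \<open>sum_y_eq_zero\<close> these are then determined, up to the error, by the projection of the
  opposed vector. If there is none, the claim follows at once. Otherwise their contribution to the
  drift is bounded by a small multiple of \<open>|y b|\<close> plus the error, as required for \<open>opposed_decays\<close>.
\<close>

lemma y_decays_half:
  assumes i: "i \<in> aligned"
  shows "decays (lam / 2) (y i)"
proof -
  define G where "G = (\<Sum>k\<in>aligned. m k)"
  define E where "E k t = (\<Sum>l\<in>aligned. m l *\<^sub>R (y k t - y l t))" for k t
  have G: "G > 0" "G \<le> 1" using aligned_mass_pos aligned_mass_le_one by (simp_all add: G_def)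
  have E: "decays (lam / 2) (E k)" if k: "k \<in> aligned" for k
    unfolding E_def[abs_def]
  proof (intro decays_sum decays_cmult)
    fix l assume "l \<in> aligned"
    show "decays (lam / 2) (\<lambda>t. y k t - y l t)"
      by (rule decays_le[OF aligned_difference_decays[OF k \<open>l \<in> aligned\<close>], of _ 1])
         (auto intro!: eventually_at_top_linorderI[of 0]
           simp: y_def norm_proj_perp_le norm_\<Omega> simp flip: proj_perp_diff)
  qed
  have y_eq: "y k t = (1 / G) *\<^sub>R (E k t - (\<Sum>b\<in>opposed. m b *\<^sub>R y b t))" if "t \<ge> 0" for k t
  proof -
    have "E k t = G *\<^sub>R y k t - (\<Sum>l\<in>aligned. m l *\<^sub>R y l t)"
      by (simp add: E_def G_def scaleR_diff_right sum_subtractf scaleR_sum_left)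
    also have "(\<Sum>l\<in>aligned. m l *\<^sub>R y l t) = - (\<Sum>b\<in>opposed. m b *\<^sub>R y b t)"
      using sum_y_eq_zero[OF that] unfolding sum_split by (simp add: eq_neg_iff_add_eq_0)
    finally show ?thesis using G by simp
  qed
  have opp: "decays (lam / 2) (y b)" if b: "b \<in> opposed" for b
  proof (rule opposed_decays[OF b])
    \<comment> \<open>The aligned mass exceeds the opposed one because \<open>lam\<close> is positive, so the common value
      of the aligned projections is at most \<open>|y b|\<close>, up to the error.\<close>
    have m_le: "m b \<le> G"
      using lam_pos by (simp add: lam_def G_def opposed_eq_singleton[OF b])
    have mb: "m b > 0" by (rule mass_pos[OF opposed_index[OF b]])
    show "decays (lam / 2) (\<lambda>t. \<Sum>k\<in>aligned. (m k * (lam / 8) / G) *\<^sub>R norm (E k t))"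
      using E by (intro decays_sum decays_cmult) (simp add: decays_def)
    have "eventually (\<lambda>t. \<forall>k\<in>aligned. 1 - c k t < lam / 8) at_top"
    proof (intro eventually_ball_finite finite_aligned ballI)
      fix k assume "k \<in> aligned"
      then have "((\<lambda>t. 1 - c k t) \<longlongrightarrow> 1 - 1) at_top"
        by (intro tendsto_intros aligned_tendsto)
      then show "eventually (\<lambda>t. 1 - c k t < lam / 8) at_top"
        by (rule order_tendstoD(2)) (use lam_pos in simp)
    qed
    then show "eventually (\<lambda>t. norm (aligned_drift t) \<le> lam / 8 * norm (y b t) +
        (\<Sum>k\<in>aligned. (m k * (lam / 8) / G) *\<^sub>R norm (E k t))) at_top"
      using eventually_ge_at_top[of 0]
    proof eventually_elim
      case (elim t)
      have "norm (aligned_drift t) \<le> (\<Sum>k\<in>aligned. norm ((m k * (1 - c k t)) *\<^sub>R y k t))"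
        unfolding aligned_drift_def by (rule norm_sum)
      also have "\<dots> \<le> (\<Sum>k\<in>aligned. m k * (lam / 8 * norm (y b t)) + (m k * (lam / 8) / G) *\<^sub>R norm (E k t))"
      proof (rule sum_mono)
        fix k assume k: "k \<in> aligned"
        have ck: "0 \<le> 1 - c k t" "1 - c k t \<le> lam / 8"
          using elim k abs_c_le_one[OF aligned_index[OF k] elim(2)] by auto
        have mk: "m k > 0" by (rule mass_pos[OF aligned_index[OF k]])
        have "norm (y k t) = norm (E k t - m b *\<^sub>R y b t) / G"
          using y_eq[OF elim(2), of k] G by (simp add: opposed_eq_singleton[OF b])
        also have "norm (E k t - m b *\<^sub>R y b t) \<le> norm (E k t) + m b * norm (y b t)"
          using norm_triangle_ineq4[of "E k t" "m b *\<^sub>R y b t"] mb by simp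
        also have "m b * norm (y b t) \<le> G * norm (y b t)"
          using m_le by (rule mult_right_mono) simp
        finally have yk: "norm (y k t) \<le> norm (y b t) + norm (E k t) / G"
          using G by (simp add: field_simps)
        have "norm ((m k * (1 - c k t)) *\<^sub>R y k t) = m k * ((1 - c k t) * norm (y k t))"
          using mk ck by (simp add: abs_mult)
        also have "\<dots> \<le> m k * (lam / 8 * (norm (y b t) + norm (E k t) / G))"
          using mk ck yk lam_pos by (intro mult_left_mono mult_mono) auto
        also have "\<dots> = m k * (lam / 8 * norm (y b t)) + (m k * (lam / 8) / G) *\<^sub>R norm (E k t)"
          by (simp add: algebra_simps)
        finally show "norm ((m k * (1 - c k t)) *\<^sub>R y k t) \<le>
          m k * (lam / 8 * norm (y b t)) + (m k * (lam / 8) / G) *\<^sub>R norm (E k t)" .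
      qed
      also have "\<dots> = G * (lam / 8 * norm (y b t)) + (\<Sum>k\<in>aligned. (m k * (lam / 8) / G) *\<^sub>R norm (E k t))"
        unfolding sum.distrib G_def sum_distrib_right ..
      also have "G * (lam / 8 * norm (y b t)) \<le> lam / 8 * norm (y b t)"
        using G lam_pos by (intro mult_left_le_one_le) auto
      finally show ?case by simp
    qed
  qed (use lam_pos in simp)
  have "decays (lam / 2) (\<lambda>t. (1 / G) *\<^sub>R (E i t - (\<Sum>b\<in>opposed. m b *\<^sub>R y b t)))"
    by (intro decays_cmult decays_diff decays_sum E i opp)
  then show ?thesis
    by (rule decays_le[of _ _ _ 1])
       (intro eventually_at_top_linorderI[of 0], simp only: y_eq[of _ i, symmetric] mult_1 order_refl)
qed

section \<open>Bootstrapping to the sharp rates\<close>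

text \<open>
  From \<open>|y i|\<^sup>2 = (1 - c i) (1 + c i)\<close>, in which the second factor is at least 1 once \<open>c i\<close> is positive.
\<close>

lemma one_minus_c_decays:
  assumes i: "i \<in> aligned" and d: "decays r (y i)"
  shows "decays (2 * r) (\<lambda>t. 1 - c i t)"
proof -
  have "eventually (\<lambda>t. c i t > 0) at_top"
    by (rule order_tendstoD(1)[OF aligned_tendsto[OF i]]) simp
  then have le: "eventually (\<lambda>t. norm (1 - c i t) \<le> 1 * norm ((norm (y i t))\<^sup>2)) at_top"
    using eventually_ge_at_top[of 0]
  proof eventually_elim
    case (elim t)
    have "\<bar>c i t\<bar> \<le> 1" by (rule abs_c_le_one[OF aligned_index[OF i] elim(2)])
    moreover from this have "(c i t)\<^sup>2 \<le> c i t"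
      using elim(1) by (simp add: power2_eq_square mult_left_le)
    ultimately show ?case
      using norm_y_power2[OF aligned_index[OF i] elim(2)] by simp
  qed
  have "decays (2 * r) (\<lambda>t. (norm (y i t))\<^sup>2)"
    using d by (simp only: decays_norm_power2_iff)
  then show ?thesis by (rule decays_le[OF _ le])
qed

lemma one_plus_c_decays:
  assumes b: "b \<in> opposed" and d: "decays r (y b)"
  shows "decays (2 * r) (\<lambda>t. 1 + c b t)"
proof -
  have "eventually (\<lambda>t. c b t < 0) at_top"
    by (rule order_tendstoD(2)[OF opposed_tendsto[OF b]]) simp
  then have le: "eventually (\<lambda>t. norm (1 + c b t) \<le> 1 * norm ((norm (y b t))\<^sup>2)) at_top"
    using eventually_ge_at_top[of 0]
  proof eventually_elim
    case (elim t)
    have c1: "\<bar>c b t\<bar> \<le> 1" by (rule abs_c_le_one[OF opposed_index[OF b] elim(2)])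
    then have "- c b t * - c b t \<le> - c b t"
      using elim(1) by (intro mult_left_le) auto
    with c1 show ?case
      using norm_y_power2[OF opposed_index[OF b] elim(2)] by (simp add: power2_eq_square)
  qed
  have "decays (2 * r) (\<lambda>t. (norm (y b t))\<^sup>2)"
    using d by (simp only: decays_norm_power2_iff)
  then show ?thesis by (rule decays_le[OF _ le])
qed

lemma c_decays_zero: "i \<in> {1..N} \<Longrightarrow> decays 0 (c i)"
  by (rule decays_bounded[of _ 1]) (auto intro!: eventually_at_top_linorderI[of 0] abs_c_le_one)

lemma \<Omega>_decays_zero: "decays 0 \<Omega>"
  by (rule decays_bounded[of _ 1]) (auto intro!: eventually_at_top_linorderI[of 0] simp: norm_\<Omega>)

lemma norm_J_decays_zero: "decays 0 (\<lambda>t. norm (J t))"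
  by (rule decays_bounded[of _ 1]) (auto intro!: eventually_at_top_linorderI[of 0] norm_J_le_one)

text \<open>
  One round of the improvement: a rate \<open>r\<close> for all aligned vectors yields the rate \<open>3 r\<close> for
  everything of higher order.
\<close>

context
  fixes r :: real
  assumes r_pos: "r > 0" and y_decays: "\<And>i. i \<in> aligned \<Longrightarrow> decays r (y i)"
begin

lemma aligned_drift_decays: "decays (3 * r) aligned_drift"
  unfolding aligned_drift_def[abs_def]
proof (rule decays_sum)
  fix i assume i: "i \<in> aligned"
  have "decays (2 * r + r) (\<lambda>t. (m i *\<^sub>R (1 - c i t)) *\<^sub>R y i t)"
    by (intro decays_scaleR decays_cmult one_minus_c_decays y_decays i)
  then show "decays (3 * r) (\<lambda>t. (m i * (1 - c i t)) *\<^sub>R y i t)"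
    by simp
qed

lemma opposed_y_decays:
  assumes b: "b \<in> opposed"
  shows "decays (3 * r) (y b)"
proof (rule opposed_decays[OF b])
  show "decays (3 * r) (\<lambda>t. norm (aligned_drift t))"
    using aligned_drift_decays by (simp add: decays_def)
  show "eventually (\<lambda>t. norm (aligned_drift t) \<le> lam / 8 * norm (y b t) + norm (aligned_drift t)) at_top"
    using lam_pos by simp
qed (use r_pos in simp)

lemma drift_decays: "decays (3 * r) drift"
proof -
  have "decays (3 * r) (\<lambda>t. (m b * (1 - c b t)) *\<^sub>R y b t)" if b: "b \<in> opposed" for b
  proof -
    have "decays (0 + 3 * r) (\<lambda>t. (m b *\<^sub>R (1 - c b t)) *\<^sub>R y b t)"
      by (intro decays_scaleR decays_cmult decays_diff decays_const c_decays_zero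
          opposed_y_decays b opposed_index)
    then show ?thesis by simp
  qed
  then show ?thesis
    unfolding drift_eq[abs_def] by (intro decays_add decays_sum aligned_drift_decays)
qed

lemma norm_J_minus_lam_decays: "decays (2 * r) (\<lambda>t. norm (J t) - lam)"
proof -
  have "decays (2 * r) (\<lambda>t. (\<Sum>b\<in>opposed. m b *\<^sub>R (1 + c b t)) - (\<Sum>i\<in>aligned. m i *\<^sub>R (1 - c i t)))"
  proof (rule decays_diff; intro decays_sum decays_cmult)
    show "decays (2 * r) (\<lambda>t. 1 - c i t)" if "i \<in> aligned" for i
      by (intro one_minus_c_decays y_decays that)
    fix b assume "b \<in> opposed"
    then have "decays (2 * (3 * r)) (\<lambda>t. 1 + c b t)"
      by (intro one_plus_c_decays opposed_y_decays)
    then show "decays (2 * r) (\<lambda>t. 1 + c b t)"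
      by (rule decays_rate_mono) (use r_pos in simp)
  qed
  then show ?thesis
  proof (rule decays_le[of _ _ _ 1], intro eventually_at_top_linorderI[of 0])
    fix t :: real assume "t \<ge> 0"
    have "norm (J t) - lam = (\<Sum>b\<in>opposed. m b *\<^sub>R (1 + c b t)) - (\<Sum>i\<in>aligned. m i *\<^sub>R (1 - c i t))"
      unfolding norm_J_eq_sum_c[OF \<open>t \<ge> 0\<close>] sum_split lam_def
      by (simp add: algebra_simps sum.distrib sum_subtractf)
    then show "norm (norm (J t) - lam) \<le>
      1 * norm ((\<Sum>b\<in>opposed. m b *\<^sub>R (1 + c b t)) - (\<Sum>i\<in>aligned. m i *\<^sub>R (1 - c i t)))"
      by simp
  qed
qed

text \<open>
  The linear part of the equation for \<open>y i\<close> is \<open>- lam y i\<close>, since \<open>|J| c i - lam\<close> decays at rate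
  \<open>2 r\<close>. All other terms decay at rate \<open>3 r\<close>.
\<close>

lemma y_expansion:
  assumes i: "i \<in> aligned" and "lam < 3 * r"
  obtains a where "decays (3 * r) (\<lambda>t. y i t - exp (- lam * t) *\<^sub>R a)"
proof -
  note ii = aligned_index[OF i]
  define g where "g t = (lam - norm (J t) * c i t) *\<^sub>R y i t - (y i t \<bullet> drift t) *\<^sub>R \<Omega> t - c i t *\<^sub>R drift t" for t
  have der: "(y i has_vector_derivative g t - lam *\<^sub>R y i t) (at t)" if "t > 0" for t
  proof -
    have "- (norm (J t) * c i t) *\<^sub>R y i t - (y i t \<bullet> drift t) *\<^sub>R \<Omega> t - c i t *\<^sub>R drift t =
        g t - lam *\<^sub>R y i t"
      by (simp add: g_def scaleR_diff_left)
    with y_derivative[OF ii that] show ?thesis by simp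
  qed
  have "decays (3 * r) g"
    unfolding g_def[abs_def]
  proof (intro decays_diff)
    have "decays (0 + 2 * r) (\<lambda>t. norm (J t) *\<^sub>R (1 - c i t))"
      by (intro decays_scaleR norm_J_decays_zero one_minus_c_decays i y_decays)
    then have "decays (2 * r) (\<lambda>t. norm (J t) *\<^sub>R (1 - c i t))"
      by simp
    from decays_scaleR[OF decays_diff[OF this norm_J_minus_lam_decays] y_decays[OF i]]
    show "decays (3 * r) (\<lambda>t. (lam - norm (J t) * c i t) *\<^sub>R y i t)"
      by (simp add: right_diff_distrib)
    have "decays (r + 3 * r + 0) (\<lambda>t. (y i t \<bullet> drift t) *\<^sub>R \<Omega> t)"
      by (intro decays_scaleR decays_inner y_decays i drift_decays \<Omega>_decays_zero)
    then show "decays (3 * r) (\<lambda>t. (y i t \<bullet> drift t) *\<^sub>R \<Omega> t)"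
      by (rule decays_rate_mono) (use r_pos in simp)
    show "decays (3 * r) (\<lambda>t. c i t *\<^sub>R drift t)"
      using decays_scaleR[OF c_decays_zero[OF ii] drift_decays] by simp
  qed
  from forced_linear_decay_expansion[OF der this assms(2)] that show thesis by blast
qed

end

text \<open>
  One round starting from \<open>r = lam / 2\<close>, which is admissible because \<open>3 r\<close> exceeds \<open>lam\<close>.
\<close>

lemma y_decays_lam:
  assumes i: "i \<in> aligned"
  shows "decays lam (y i)"
proof -
  obtain a where "decays (3 * (lam / 2)) (\<lambda>t. y i t - exp (- lam * t) *\<^sub>R a)"
    by (rule y_expansion[of "lam / 2" i]) (use lam_pos y_decays_half i in auto)
  then have "decays lam (\<lambda>t. y i t - exp (- lam * t) *\<^sub>R a)"
    by (rule decays_rate_mono) (use lam_pos in simp)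
  moreover have "decays (lam + 0) (\<lambda>t. exp (- lam * t) *\<^sub>R a)"
    by (intro decays_scaleR decays_exp decays_const)
  ultimately show ?thesis
    using decays_add[of lam "\<lambda>t. y i t - exp (- lam * t) *\<^sub>R a" "\<lambda>t. exp (- lam * t) *\<^sub>R a"] by simp
qed

section \<open>Asymptotic expansions\<close>

lemma sharp_opposed_y_decays: "b \<in> opposed \<Longrightarrow> decays (3 * lam) (y b)"
  by (rule opposed_y_decays[OF lam_pos y_decays_lam])

lemma sharp_drift_decays: "decays (3 * lam) drift"
  by (rule drift_decays[OF lam_pos y_decays_lam])

lemma mean_direction_limit:
  obtains w where "norm w = 1" "decays (3 * lam) (\<lambda>t. \<Omega> t - w)"
proof -
  obtain w where w: "decays (3 * lam) (\<lambda>t. \<Omega> t - w)"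
    using integrable_decay_converges[OF \<Omega>_derivative sharp_drift_decays] lam_pos by auto
  then have "((\<lambda>t. \<Omega> t - w) \<longlongrightarrow> 0) at_top"
    by (rule decays_tendsto_zero) (use lam_pos in simp)
  then have "((\<lambda>t. norm (\<Omega> t)) \<longlongrightarrow> norm w) at_top"
    by (intro tendsto_norm) (rule LIM_zero_cancel)
  moreover have "((\<lambda>t. norm (\<Omega> t)) \<longlongrightarrow> 1) at_top"
    by (intro tendsto_eventually eventually_at_top_linorderI[of 0]) (simp add: norm_\<Omega>)
  ultimately have "norm w = 1"
    by (rule tendsto_unique[OF trivial_limit_at_top_linorder])
  then show thesis using w by (rule that)
qed

lemma aligned_limit:
  assumes w: "decays (3 * lam) (\<lambda>t. \<Omega> t - w)" and i: "i \<in> aligned"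
  shows "decays lam (\<lambda>t. v i t - w)"
proof -
  have "decays lam (\<lambda>t. y i t + c i t *\<^sub>R (\<Omega> t - w) - (1 - c i t) *\<^sub>R w)"
  proof (intro decays_add decays_diff y_decays_lam i)
    show "decays lam (\<lambda>t. c i t *\<^sub>R (\<Omega> t - w))"
      by (rule decays_rate_mono[OF decays_scaleR[OF c_decays_zero[OF aligned_index[OF i]] w]])
         (use lam_pos in simp)
    show "decays lam (\<lambda>t. (1 - c i t) *\<^sub>R w)"
      by (rule decays_rate_mono[OF decays_scaleR[OF one_minus_c_decays[OF i y_decays_lam[OF i]] decays_const]])
         (use lam_pos in simp)
  qed
  moreover have "y i t + c i t *\<^sub>R (\<Omega> t - w) - (1 - c i t) *\<^sub>R w = v i t - w" for t
    by (subst v_decomp) (simp add: algebra_simps)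
  ultimately show ?thesis by simp
qed

lemma opposed_limit:
  assumes w: "decays (3 * lam) (\<lambda>t. \<Omega> t - w)" and b: "b \<in> opposed"
  shows "decays (3 * lam) (\<lambda>t. v b t + w)"
proof -
  have "decays (3 * lam) (\<lambda>t. y b t + c b t *\<^sub>R (\<Omega> t - w) + (1 + c b t) *\<^sub>R w)"
  proof (intro decays_add sharp_opposed_y_decays b)
    show "decays (3 * lam) (\<lambda>t. c b t *\<^sub>R (\<Omega> t - w))"
      using decays_scaleR[OF c_decays_zero[OF opposed_index[OF b]] w] by simp
    show "decays (3 * lam) (\<lambda>t. (1 + c b t) *\<^sub>R w)"
      by (rule decays_rate_mono[OF decays_scaleR[OF one_plus_c_decays[OF b sharp_opposed_y_decays[OF b]] decays_const]])
         (use lam_pos in simp_all)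
  qed
  moreover have "y b t + c b t *\<^sub>R (\<Omega> t - w) + (1 + c b t) *\<^sub>R w = v b t + w" for t
    by (subst v_decomp) (simp add: algebra_simps)
  ultimately show ?thesis by simp
qed

text \<open>
  The component along \<open>\<Omega>\<close> carries the second order term. From \<open>|y i|\<^sup>2 = 1 - (c i)\<^sup>2\<close> one gets
  \<open>1 - c i = |y i|\<^sup>2 / 2 + (1 - c i)\<^sup>2 / 2\<close>, and replacing \<open>y i\<close> by \<open>exp (- lam t) a\<close> changes this by
  \<open>O(exp (- 4 lam t))\<close> only.
\<close>

lemma aligned_expansion:
  assumes w: "decays (3 * lam) (\<lambda>t. \<Omega> t - w)" and i: "i \<in> aligned"
    and a: "decays (3 * lam) (\<lambda>t. y i t - exp (- lam * t) *\<^sub>R a)"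
  shows "decays (3 * lam) (\<lambda>t. v i t -
    ((1 - (norm a)\<^sup>2 / 2 * exp (- 2 * lam * t)) *\<^sub>R w + exp (- lam * t) *\<^sub>R a))"
proof -
  note ii = aligned_index[OF i] and yd = y_decays_lam[OF i]
  define e where "e t = exp (- lam * t)" for t
  have e2: "exp (- 2 * lam * t) = (e t)\<^sup>2" for t
    by (simp add: e_def flip: exp_of_nat_mult)
  define D where "D t = (1 - c i t) - (norm a)\<^sup>2 / 2 * (e t)\<^sup>2" for t
  have "decays (4 * lam) (\<lambda>t. (1 / 2) *\<^sub>R (norm (1 - c i t))\<^sup>2 +
      (1 / 2) *\<^sub>R ((y i t - e t *\<^sub>R a) \<bullet> (y i t + e t *\<^sub>R a)))"
  proof (intro decays_add decays_cmult)
    show "decays (4 * lam) (\<lambda>t. (norm (1 - c i t))\<^sup>2)"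
      using one_minus_c_decays[OF i yd] decays_norm_power2_iff[of "2 * lam" "\<lambda>t. 1 - c i t"] by simp
    have "decays (lam + 0) (\<lambda>t. e t *\<^sub>R a)"
      unfolding e_def by (intro decays_scaleR decays_exp decays_const)
    then have "decays (3 * lam + lam) (\<lambda>t. (y i t - e t *\<^sub>R a) \<bullet> (y i t + e t *\<^sub>R a))"
      using a yd unfolding e_def by (intro decays_inner decays_add) simp_all
    then show "decays (4 * lam) (\<lambda>t. (y i t - e t *\<^sub>R a) \<bullet> (y i t + e t *\<^sub>R a))"
      by simp
  qed
  then have "decays (4 * lam) D"
  proof (rule decays_le[of _ _ _ 1], intro eventually_at_top_linorderI[of 0])
    fix t :: real assume t: "t \<ge> 0"
    have "(y i t - e t *\<^sub>R a) \<bullet> (y i t + e t *\<^sub>R a) = (norm (y i t))\<^sup>2 - (e t)\<^sup>2 * (norm a)\<^sup>2"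
      unfolding power2_norm_eq_inner
      by (simp add: inner_diff_left inner_add_right inner_commute[of a "y i t"] power2_eq_square
          algebra_simps)
    then have "D t = (1 / 2) *\<^sub>R (norm (1 - c i t))\<^sup>2 +
      (1 / 2) *\<^sub>R ((y i t - e t *\<^sub>R a) \<bullet> (y i t + e t *\<^sub>R a))"
      unfolding norm_y_power2[OF ii t] D_def by (simp add: power2_eq_square field_simps)
    then show "norm (D t) \<le> 1 * norm ((1 / 2) *\<^sub>R (norm (1 - c i t))\<^sup>2 +
      (1 / 2) *\<^sub>R ((y i t - e t *\<^sub>R a) \<bullet> (y i t + e t *\<^sub>R a)))"
      by simp
  qed
  then have D: "decays (3 * lam) D"
    by (rule decays_rate_mono) (use lam_pos in simp)
  have "decays (3 * lam) (\<lambda>t. (y i t - e t *\<^sub>R a) + c i t *\<^sub>R (\<Omega> t - w) - D t *\<^sub>R w)"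
  proof (rule decays_diff[OF decays_add])
    show "decays (3 * lam) (\<lambda>t. y i t - e t *\<^sub>R a)"
      using a by (simp add: e_def)
    show "decays (3 * lam) (\<lambda>t. c i t *\<^sub>R (\<Omega> t - w))"
      using decays_scaleR[OF c_decays_zero[OF ii] w] by simp
    show "decays (3 * lam) (\<lambda>t. D t *\<^sub>R w)"
      using decays_scaleR[OF D decays_const] by simp
  qed
  moreover have "(y i t - e t *\<^sub>R a) + c i t *\<^sub>R (\<Omega> t - w) - D t *\<^sub>R w =
      v i t - ((1 - (norm a)\<^sup>2 / 2 * (e t)\<^sup>2) *\<^sub>R w + e t *\<^sub>R a)" for t
    by (subst v_decomp) (simp add: D_def algebra_simps)
  ultimately show ?thesis
    by (simp only: e2 e_def[symmetric])
qed

lemma coefficient_limit: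
  assumes "decays (3 * lam) (\<lambda>t. y i t - exp (- lam * t) *\<^sub>R a)"
  shows "((\<lambda>t. exp (lam * t) *\<^sub>R y i t) \<longlongrightarrow> a) at_top"
proof -
  have "decays (- lam + 3 * lam) (\<lambda>t. exp (- (- lam) * t) *\<^sub>R (y i t - exp (- lam * t) *\<^sub>R a))"
    by (intro decays_scaleR decays_exp assms)
  then have "((\<lambda>t. exp (lam * t) *\<^sub>R y i t - a) \<longlongrightarrow> 0) at_top"
    using lam_pos by (intro decays_tendsto_zero[of "- lam + 3 * lam"])
      (simp_all add: scaleR_diff_right mult_exp_exp)
  then show ?thesis by (rule LIM_zero_cancel)
qed

text \<open>
  The two linear constraints on the coefficients are the limits of \<open>y i \<bullet> \<Omega> = 0\<close> and \<open>\<Sum> m i y i = 0\<close>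
  after multiplication by \<open>exp (lam t)\<close>. The opposed vector drops out of the second one because of its faster
  decay.
\<close>

theorem asymptotics:
  obtains w a where "norm w = 1" "decays (3 * lam) (\<lambda>t. \<Omega> t - w)"
    "\<And>i. i \<in> aligned \<Longrightarrow> a i \<bullet> w = 0" "(\<Sum>i\<in>aligned. m i *\<^sub>R a i) = 0"
    "\<And>i. i \<in> aligned \<Longrightarrow> decays lam (\<lambda>t. v i t - w)"
    "\<And>i. i \<in> aligned \<Longrightarrow> decays (3 * lam) (\<lambda>t. v i t -
      ((1 - (norm (a i))\<^sup>2 / 2 * exp (- 2 * lam * t)) *\<^sub>R w + exp (- lam * t) *\<^sub>R a i))"
    "\<And>b. b \<in> opposed \<Longrightarrow> decays (3 * lam) (\<lambda>t. v b t + w)"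
proof -
  obtain w where w: "norm w = 1" "decays (3 * lam) (\<lambda>t. \<Omega> t - w)"
    by (rule mean_direction_limit)
  have "\<exists>a. decays (3 * lam) (\<lambda>t. y i t - exp (- lam * t) *\<^sub>R a)" if "i \<in> aligned" for i
    using y_expansion[OF lam_pos y_decays_lam that] lam_pos by auto
  then obtain a where a: "\<And>i. i \<in> aligned \<Longrightarrow> decays (3 * lam) (\<lambda>t. y i t - exp (- lam * t) *\<^sub>R a i)"
    by metis
  have \<Omega>_lim: "(\<Omega> \<longlongrightarrow> w) at_top"
    by (rule LIM_zero_cancel[OF decays_tendsto_zero[OF w(2)]]) (use lam_pos in simp)
  have "a i \<bullet> w = 0" if i: "i \<in> aligned" for i
  proof (rule tendsto_unique[OF trivial_limit_at_top_linorder])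
    show "((\<lambda>t. (exp (lam * t) *\<^sub>R y i t) \<bullet> \<Omega> t) \<longlongrightarrow> a i \<bullet> w) at_top"
      by (intro tendsto_inner coefficient_limit a i \<Omega>_lim)
    show "((\<lambda>t. (exp (lam * t) *\<^sub>R y i t) \<bullet> \<Omega> t) \<longlongrightarrow> 0) at_top"
      using y_orthogonal[of _ i]
      by (intro tendsto_eventually eventually_at_top_linorderI[of 0]) (simp add: inner_commute)
  qed
  moreover have "(\<Sum>i\<in>aligned. m i *\<^sub>R a i) = 0"
  proof (rule tendsto_unique[OF trivial_limit_at_top_linorder])
    show "((\<lambda>t. \<Sum>i\<in>aligned. m i *\<^sub>R (exp (lam * t) *\<^sub>R y i t)) \<longlongrightarrow> (\<Sum>i\<in>aligned. m i *\<^sub>R a i)) at_top"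
      by (intro tendsto_sum tendsto_scaleR tendsto_const coefficient_limit a)
    have "decays (- lam + 3 * lam) (\<lambda>t. exp (- (- lam) * t) *\<^sub>R (\<Sum>b\<in>opposed. - m b *\<^sub>R y b t))"
      by (intro decays_scaleR decays_exp decays_sum decays_cmult sharp_opposed_y_decays)
    then have "((\<lambda>t. exp (lam * t) *\<^sub>R (\<Sum>b\<in>opposed. - m b *\<^sub>R y b t)) \<longlongrightarrow> 0) at_top"
      using lam_pos by (intro decays_tendsto_zero[of "- lam + 3 * lam"]) simp_all
    moreover have "exp (lam * t) *\<^sub>R (\<Sum>b\<in>opposed. - m b *\<^sub>R y b t) =
        (\<Sum>i\<in>aligned. m i *\<^sub>R (exp (lam * t) *\<^sub>R y i t))" if "t \<ge> 0" for t
    proof -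
      have "(\<Sum>b\<in>opposed. - m b *\<^sub>R y b t) = (\<Sum>i\<in>aligned. m i *\<^sub>R y i t)"
        using sum_y_eq_zero[OF that] unfolding sum_split
        by (simp add: sum_negf neg_eq_iff_add_eq_0 add.commute)
      then show ?thesis by (simp add: scaleR_sum_right mult.commute)
    qed
    then have "eventually (\<lambda>t. exp (lam * t) *\<^sub>R (\<Sum>b\<in>opposed. - m b *\<^sub>R y b t) =
        (\<Sum>i\<in>aligned. m i *\<^sub>R (exp (lam * t) *\<^sub>R y i t))) at_top"
      by (intro eventually_at_top_linorderI[of 0])
    ultimately show "((\<lambda>t. \<Sum>i\<in>aligned. m i *\<^sub>R (exp (lam * t) *\<^sub>R y i t)) \<longlongrightarrow> 0) at_top"
      by (rule Lim_transform_eventually)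
  qed
  ultimately show thesis
    using that[of w a] w aligned_limit[OF w(2)] aligned_expansion[OF w(2) _ a] opposed_limit[OF w(2)]
    by blast
qed

end

theorem theorem2:
  fixes N :: nat
    and m :: "nat \<Rightarrow> real"
    and v0 :: "nat \<Rightarrow> real ^ 'n"
    and v :: "nat \<Rightarrow> real \<Rightarrow> real ^ 'n"
  defines "J \<equiv> mean_vec N m v"
    and "\<Omega> \<equiv> mean_dir N m v"
  assumes "\<And>i. i \<in> {1..N} \<Longrightarrow> m i > 0"
    and "(\<Sum>i=1..N. m i) = 1"
    and "\<And>i. i \<in> {1..N} \<Longrightarrow> v0 i \<in> sphere 0 1"
    and "\<And>i j. i \<in> {1..N} \<Longrightarrow> j \<in> {1..N} \<Longrightarrow> i \<noteq> j \<Longrightarrow> v0 i \<noteq> v0 j"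
    and "aggregation_solution N m v0 v"
    and "J 0 \<noteq> 0"
  shows "mono_on {0..} (\<lambda>t. norm (J t)) \<and>
    (\<forall>t\<ge>0. J t \<noteq> 0 \<and> \<Omega> t \<in> sphere 0 1) \<and>
    (\<exists>\<omega> \<in> sphere 0 1.
       (\<Omega> \<longlongrightarrow> \<omega>) at_top \<and>
       ((\<forall>i\<in>{1..N}. (v i \<longlongrightarrow> \<omega>) at_top) \<or> (\<exists>i0\<in>{1..N}. (v i0 \<longlongrightarrow> - \<omega>) at_top)) \<and>
       ((\<forall>i\<in>{1..N}. (v i \<longlongrightarrow> \<omega>) at_top) \<longrightarrow>
          (\<forall>i\<in>{1..N}. big_O_exp (v i) (\<lambda>t. \<omega>) 1) \<and>
          big_O_exp \<Omega> (\<lambda>t. \<omega>) 3 \<and>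
          (\<exists>a. (\<forall>i\<in>{1..N}. a i \<bullet> \<omega> = 0) \<and>
               (\<Sum>i=1..N. m i *\<^sub>R a i) = 0 \<and>
               (\<forall>i\<in>{1..N}. big_O_exp (v i)
                  (\<lambda>t. (1 - (norm (a i))\<^sup>2 / 2 * exp (- 2 * t)) *\<^sub>R \<omega> + exp (- t) *\<^sub>R a i) 3))) \<and>
       (\<forall>i0\<in>{1..N}. (v i0 \<longlongrightarrow> - \<omega>) at_top \<longrightarrow>
          m i0 < 1 / 2 \<and>
          (let lam = 1 - 2 * m i0 in
             (\<forall>i\<in>{1..N} - {i0}. (v i \<longlongrightarrow> \<omega>) at_top \<and> big_O_exp (v i) (\<lambda>t. \<omega>) lam) \<and>
             big_O_exp (v i0) (\<lambda>t. - \<omega>) (3 * lam) \<and>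
             big_O_exp \<Omega> (\<lambda>t. \<omega>) (3 * lam) \<and>
             (\<exists>a. (\<forall>i\<in>{1..N} - {i0}. a i \<bullet> \<omega> = 0) \<and>
                  (\<Sum>i\<in>{1..N} - {i0}. m i *\<^sub>R a i) = 0 \<and>
                  (\<forall>i\<in>{1..N} - {i0}. big_O_exp (v i)
                     (\<lambda>t. (1 - (norm (a i))\<^sup>2 / 2 * exp (- 2 * lam * t)) *\<^sub>R \<omega>
                          + exp (- lam * t) *\<^sub>R a i) (3 * lam))))))"
proof -
  interpret aggregation N m v0 v
    using assms(3-8) unfolding J_def by unfold_locales auto
  obtain w a where w: "norm w = 1" "decays (3 * lam) (\<lambda>t. \<Omega> t - w)"
    and a: "\<And>i. i \<in> aligned \<Longrightarrow> a i \<bullet> w = 0" "(\<Sum>i\<in>aligned. m i *\<^sub>R a i) = 0"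
    and lim: "\<And>i. i \<in> aligned \<Longrightarrow> decays lam (\<lambda>t. v i t - w)"
    and expansion: "\<And>i. i \<in> aligned \<Longrightarrow> decays (3 * lam) (\<lambda>t. v i t -
      ((1 - (norm (a i))\<^sup>2 / 2 * exp (- 2 * lam * t)) *\<^sub>R w + exp (- lam * t) *\<^sub>R a i))"
    and opp: "\<And>b. b \<in> opposed \<Longrightarrow> decays (3 * lam) (\<lambda>t. v b t + w)"
    unfolding \<Omega>_def by (rule asymptotics) blast
  have lam3: "3 * lam > 0" using lam_pos by simp
  have \<Omega>_lim: "(\<Omega> \<longlongrightarrow> w) at_top"
    by (rule LIM_zero_cancel[OF decays_tendsto_zero[OF w(2) lam3]])
  have aligned_lim: "(v i \<longlongrightarrow> w) at_top" if "i \<in> aligned" for i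
    by (rule LIM_zero_cancel[OF decays_tendsto_zero[OF lim[OF that] lam_pos]])
  have opposed_lim: "(v b \<longlongrightarrow> - w) at_top" if "b \<in> opposed" for b
    by (rule LIM_zero_cancel) (use decays_tendsto_zero[OF opp[OF that] lam3] in simp)
  \<comment> \<open>The behaviour of a single vector tells the two regimes apart, since it cannot converge to
    both \<open>w\<close> and \<open>- w\<close>.\<close>
  have w_neq: "w \<noteq> - w"
    using w(1) by (auto simp: eq_neg_iff_add_eq_0 scaleR_2[symmetric])
  have excl: False if "(f \<longlongrightarrow> w) at_top" "(f \<longlongrightarrow> - w) at_top" for f :: "real \<Rightarrow> real ^ 'n"
    using tendsto_unique[OF trivial_limit_at_top_linorder that] w_neq by contradiction
  have all_aligned: "aligned = {1..N} \<and> lam = 1" if "\<forall>i\<in>{1..N}. (v i \<longlongrightarrow> w) at_top"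
  proof -
    have "opposed = {}"
      using that opposed_lim opposed_index excl by blast
    then show ?thesis
      using aligned_Un_opposed mass_sum by (simp add: lam_def)
  qed
  have one_opposed: "opposed = {i0} \<and> aligned = {1..N} - {i0} \<and> lam = 1 - 2 * m i0"
    if "i0 \<in> {1..N}" "(v i0 \<longlongrightarrow> - w) at_top" for i0
  proof -
    have "i0 \<notin> aligned" using that(2) aligned_lim excl by blast
    with that(1) have "i0 \<in> opposed" using aligned_Un_opposed by blast
    then have "opposed = {i0}" by (rule opposed_eq_singleton)
    moreover from this have "aligned = {1..N} - {i0}"
      using aligned_Un_opposed aligned_Int_opposed by blast
    moreover have "(\<Sum>i\<in>aligned. m i) + (\<Sum>i\<in>opposed. m i) = 1"
      using mass_sum unfolding sum_split .
    ultimately show ?thesis by (simp add: lam_def)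
  qed
  show ?thesis
  proof (intro conjI bexI[of _ w] ballI impI)
    show "mono_on {0..} (\<lambda>t. norm (J t))"
      unfolding J_def by (intro mono_onI norm_J_mono) auto
    show "\<forall>t\<ge>0. J t \<noteq> 0 \<and> \<Omega> t \<in> sphere 0 1"
      using norm_J_pos norm_\<Omega> unfolding J_def \<Omega>_def by auto
    show "(\<Omega> \<longlongrightarrow> w) at_top" by (rule \<Omega>_lim)
    show "w \<in> sphere 0 1" using w(1) by simp
    show "(\<forall>i\<in>{1..N}. (v i \<longlongrightarrow> w) at_top) \<or> (\<exists>i0\<in>{1..N}. (v i0 \<longlongrightarrow> - w) at_top)"
    proof (cases "opposed = {}")
      case True
      then show ?thesis using aligned_Un_opposed aligned_lim by blast
    next
      case False
      then show ?thesis using opposed_lim opposed_index by blast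
    qed
  next
    assume "\<forall>i\<in>{1..N}. (v i \<longlongrightarrow> w) at_top"
    then have al: "aligned = {1..N}" and l: "lam = 1" using all_aligned by auto
    show "big_O_exp (v i) (\<lambda>t. w) 1" if "i \<in> {1..N}" for i
      using lim[of i] that by (simp add: al l big_O_exp_iff_decays)
    show "big_O_exp \<Omega> (\<lambda>t. w) 3"
      using w(2) by (simp add: l big_O_exp_iff_decays)
    show "\<exists>a. (\<forall>i\<in>{1..N}. a i \<bullet> w = 0) \<and> (\<Sum>i=1..N. m i *\<^sub>R a i) = 0 \<and>
      (\<forall>i\<in>{1..N}. big_O_exp (v i)
        (\<lambda>t. (1 - (norm (a i))\<^sup>2 / 2 * exp (- 2 * t)) *\<^sub>R w + exp (- t) *\<^sub>R a i) 3)"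
      using a expansion unfolding al l big_O_exp_iff_decays
      by (intro exI[of _ a]) simp
  next
    fix i0 assume "i0 \<in> {1..N}" "(v i0 \<longlongrightarrow> - w) at_top"
    from one_opposed[OF this] have op: "opposed = {i0}" and al: "aligned = {1..N} - {i0}"
      and l: "1 - 2 * m i0 = lam" by auto
    show "m i0 < 1 / 2" using lam_pos l by simp
    have "big_O_exp (v i0) (\<lambda>t. - w) (3 * lam)"
      using opp[of i0] by (simp add: op big_O_exp_iff_decays)
    then show "let lam = 1 - 2 * m i0 in
             (\<forall>i\<in>{1..N} - {i0}. (v i \<longlongrightarrow> w) at_top \<and> big_O_exp (v i) (\<lambda>t. w) lam) \<and>
             big_O_exp (v i0) (\<lambda>t. - w) (3 * lam) \<and>
             big_O_exp \<Omega> (\<lambda>t. w) (3 * lam) \<and>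
             (\<exists>a. (\<forall>i\<in>{1..N} - {i0}. a i \<bullet> w = 0) \<and>
                  (\<Sum>i\<in>{1..N} - {i0}. m i *\<^sub>R a i) = 0 \<and>
                  (\<forall>i\<in>{1..N} - {i0}. big_O_exp (v i)
                     (\<lambda>t. (1 - (norm (a i))\<^sup>2 / 2 * exp (- 2 * lam * t)) *\<^sub>R w
                          + exp (- lam * t) *\<^sub>R a i) (3 * lam)))"
      using a expansion w(2) lim aligned_lim
      unfolding l Let_def al[symmetric] big_O_exp_iff_decays
      by blast
  qed
qed

end
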